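(* Let $\Bbbk$, $A$, $f$, $A_f$ be as in the context, and let $M$ be an $A$-module satisfying condition $(\ast A)$, with minimal projective resolution $\cdots\to Q_1\xrightarrow{\delta_1}Q_0\xrightarrow{\delta_0}M\to0$ as in that condition. Then there are $\Bbbk$-linear maps $T_i\colon Q_i\to Q_{i-1}$ ($i\geq 1$) such that, for every $i\ge1$, $T_i(ax)-aT_i(x)=(-1)^{i+1}\bigl(f_{Q_{i-1}}(a\otimes\delta_i(x))-\delta_i(f_{Q_i}(a\otimes x))\bigr)$ for all $a\in A$, $x\in Q_i$, and $T_i\delta_{i+1}=\delta_iT_{i+1}$, and the $A_f$-module $M=(0,M,0,0)$ admits the minimal projective resolution $$\cdots\to\bigoplus_{i=0}^m\hat Q_i\xrightarrow{\hat\delta_m}\bigoplus_{i=0}^{m-1}\hat Q_i\to\cdots\to\hat Q_0\oplus\hat Q_1\xrightarrow{\hat\delta_1}\hat Q_0\xrightarrow{\hat\delta_0}M\to0,$$ where $\hat\delta_0=(0,\delta_0,0)$ and, for $m\ge1$, $\hat\delta_m=(u_m,v_m,u_m)$, with $u_m,v_m\colon\bigoplus_{i=0}^mQ_i\to\bigoplus_{i=0}^{m-1}Q_i$ such that, for $1\le i\le m$, the component in $Q_{i-1}$ of $u_m(x_0,\dots,x_m)$ is $\delta_i(x_i)$ and that of $v_m(x_0,\dots,x_m)$ is $(-1)^{i-1}(x_{i-1}+T_i(x_i))$.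
   Context: Setting. $\Bbbk$ is an algebraically closed field, $A$ a finite dimensional associative unital $\Bbbk$-algebra, all modules are finite dimensional left modules. $1=\sum_{i=1}^n e_i$ is a decomposition into primitive orthogonal idempotents such that $P_i=Ae_i$ form a complete set of representatives of isomorphism classes of indecomposable projective $A$-modules. $f\colon A\otimes_\Bbbk A\to A$ is a Hochschild $2$-cocycle: $af(b\otimes c)-f(ab\otimes c)+f(a\otimes bc)-f(a\otimes b)c=0$. $A_f=A[t]/(t^2)\simeq A\oplus A$ is the algebra with product $(a_0+a_1t)(b_0+b_1t)=a_0b_0+(a_0b_1+a_1b_0+f(a_0\otimes b_0))t$. $A_f$-modules. $\operatorname{mod}A_f$ is identified with the category of tuples $(M_0,M_1,T_M,f_M)$, $M_0,M_1\in\operatorname{mod}A$, $T_M\in\operatorname{Hom}_A(M_0,M_1)$ a monomorphism, $f_M\in\operatorname{Hom}_\Bbbk(A\otimes_\Bbbk M_0,M_1)$ with $af_M(b\otimes m)-f_M(ab\otimes m)+f_M(a\otimes bm)-f(a\otimes b)T_M(m)=0$; the tuple corresponds to $M_0\oplus M_1$ with $(a+bt)(m_0,m_1)=(am_0,\,am_1+bT_M(m_0)+f_M(a\otimes m_0))$. Morphisms $(M_0,M_1,T_M,f_M)\to(N_0,N_1,T_N,f_N)$ are triples $(u_0,u_1,u_2)$, $u_0\in\operatorname{Hom}_A(M_0,N_0)$, $u_2\in\operatorname{Hom}_A(M_1,N_1)$, $u_1\in\operatorname{Hom}_\Bbbk(M_0,N_1)$, with $T_Nu_0=u_2T_M$ and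 $u_1(am)=au_1(m)-u_2(f_M(a\otimes m))+f_N(a\otimes u_0(m))$, corresponding to $(m_0,m_1)\mapsto(u_0(m_0),u_1(m_0)+u_2(m_1))$; composition is $(v_0,v_1,v_2)(u_0,u_1,u_2)=(v_0u_0,\,v_2u_1+v_1u_0,\,v_2u_2)$. An $A$-module $M$ is viewed as the $A_f$-module $(0,M,0,0)$. Projectives. Every projective $A$-module $Q$ is taken with a decomposition $Q=\bigoplus_{r=1}^m Ae_{i_r}$; for $x=\sum x_r\in Q$, $x_r\in Ae_{i_r}$, write $[x]=[x_1\cdots x_m]$; $E\in M_m(A)$ is the diagonal matrix with entries $e_{i_1},\dots,e_{i_m}$. $f_Q\colon A\otimes Q\to Q$ is $f_Q(a\otimes x)=\sum_r f(a\otimes x_r)e_{i_r}$, and $\hat Q=(Q,Q,\mathrm{Id},f_Q)$, a projective $A_f$-module. A morphism $\delta\colon Q\to Q'$ of projective $A$-modules is given by a matrix $B$ with $EBE'=B$ via $[\delta(x)]=[x]B$. For matrices over $A$ of compatible sizes, $\tilde f(B\otimes B')_{ij}=\sum_l f(b_{il}\otimes b'_{lj})$. Condition $(\ast A)$. An $A$-module $M$ satisfies $(\ast A)$ if it has a minimal projective resolution $\cdots\to Q_1\xrightarrow{\delta_1}Q_0\xrightarrow{\delta_0}M\to0$ such that, with $B_1$ the matrix of $\delta_1$ and $E_0$ the diagonal matrix of $Q_0$, the linear map $T_{\delta_1}\colon Q_1\to Q_0$, $[T_{\delta_1}(x)]=\tilde f([x]\otimes B_1)E_0$, satisfies $\delta_0T_{\delta_1}=0$.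 *)

theory Defs
  imports
    "HOL-Computational_Algebra.Polynomial"
    "HOL-Library.Function_Algebras"
    "HOL-Library.Product_Plus"
begin

section \<open>Finite dimensional algebras and their left modules\<close>

text \<open>
  The multiplication of a deformed algebra depends on the cocycle, so it cannot be a type class
  operation; algebras are therefore records over an additive group.
\<close>

record ('k, 'r) kalg =
  ascale :: "'k \<Rightarrow> 'r \<Rightarrow> 'r"
  amult :: "'r \<Rightarrow> 'r \<Rightarrow> 'r"
  aone :: "'r"

locale fd_algebra =
  fixes A :: "('k::field, 'r::ab_group_add) kalg"
  assumes vector_space: "vector_space (ascale A)"
    and finite_dim: "\<exists>B. finite B \<and> module.span (ascale A) B = UNIV"
    and mult_linear_right: "Vector_Spaces.linear (ascale A) (ascale A) (\<lambda>b. amult A a b)"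
    and mult_linear_left: "Vector_Spaces.linear (ascale A) (ascale A) (\<lambda>a. amult A a b)"
    and mult_assoc: "amult A (amult A a b) c = amult A a (amult A b c)"
    and one_left: "amult A (aone A) a = a"
    and one_right: "amult A a (aone A) = a"

text \<open>A module is an additive subgroup of a type together with an action of the algebra.\<close>

record ('r, 'm) lmod =
  mcar :: "'m set"
  mact :: "'r \<Rightarrow> 'm \<Rightarrow> 'm"

locale left_module =
  fixes A :: "('k::field, 'r::ab_group_add) kalg" and M :: "('r, 'm::ab_group_add) lmod"
  assumes zero_closed: "0 \<in> mcar M"
    and add_closed: "x \<in> mcar M \<Longrightarrow> y \<in> mcar M \<Longrightarrow> x + y \<in> mcar M"
    and minus_closed: "x \<in> mcar M \<Longrightarrow> - x \<in> mcar M"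
    and act_closed: "x \<in> mcar M \<Longrightarrow> mact M a x \<in> mcar M"
    and act_add_right: "x \<in> mcar M \<Longrightarrow> y \<in> mcar M \<Longrightarrow> mact M a (x + y) = mact M a x + mact M a y"
    and act_add_left: "x \<in> mcar M \<Longrightarrow> mact M (a + b) x = mact M a x + mact M b x"
    and act_mult: "x \<in> mcar M \<Longrightarrow> mact M (amult A a b) x = mact M a (mact M b x)"
    and act_one: "x \<in> mcar M \<Longrightarrow> mact M (aone A) x = x"

text \<open>The ground field acts on a module through the scalar multiples of the unit.\<close>

definition kact :: "('k, 'r) kalg \<Rightarrow> ('r, 'm) lmod \<Rightarrow> 'k \<Rightarrow> 'm \<Rightarrow> 'm" where
  "kact A M c x = mact M (ascale A c (aone A)) x"

definition fd_module :: "('k::field, 'r::ab_group_add) kalg \<Rightarrow> ('r, 'm::ab_group_add) lmod \<Rightarrow> bool" where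
  "fd_module A M \<longleftrightarrow> left_module A M \<and>
     (\<exists>B. finite B \<and> B \<subseteq> mcar M \<and> (\<forall>x\<in>mcar M. \<exists>c. x = (\<Sum>b\<in>B. kact A M (c b) b)))"

definition lmod_hom ::
  "('r, 'm::ab_group_add) lmod \<Rightarrow> ('r, 'n::ab_group_add) lmod \<Rightarrow> ('m \<Rightarrow> 'n) \<Rightarrow> bool" where
  "lmod_hom M N h \<longleftrightarrow>
     (\<forall>x\<in>mcar M. h x \<in> mcar N) \<and>
     (\<forall>x\<in>mcar M. \<forall>y\<in>mcar M. h (x + y) = h x + h y) \<and>
     (\<forall>a. \<forall>x\<in>mcar M. h (mact M a x) = mact N a (h x))"

definition k_linear ::
  "('k, 'r) kalg \<Rightarrow> ('r, 'm::ab_group_add) lmod \<Rightarrow> ('r, 'n::ab_group_add) lmod \<Rightarrow> ('m \<Rightarrow> 'n) \<Rightarrow> bool" where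
  "k_linear A M N h \<longleftrightarrow>
     (\<forall>x\<in>mcar M. h x \<in> mcar N) \<and>
     (\<forall>x\<in>mcar M. \<forall>y\<in>mcar M. h (x + y) = h x + h y) \<and>
     (\<forall>c. \<forall>x\<in>mcar M. h (kact A M c x) = kact A N c (h x))"

definition lmod_isomorphic ::
  "('r, 'm::ab_group_add) lmod \<Rightarrow> ('r, 'n::ab_group_add) lmod \<Rightarrow> bool" where
  "lmod_isomorphic M N \<longleftrightarrow> (\<exists>h. lmod_hom M N h \<and> bij_betw h (mcar M) (mcar N))"

definition kernel_module :: "('r, 'm) lmod \<Rightarrow> ('m \<Rightarrow> 'n::zero) \<Rightarrow> ('r, 'm) lmod" where
  "kernel_module M h = M\<lparr>mcar := {x \<in> mcar M. h x = 0}\<rparr>"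

definition submodule ::
  "('k::field, 'r::ab_group_add) kalg \<Rightarrow> ('r, 'm::ab_group_add) lmod \<Rightarrow> 'm set \<Rightarrow> bool" where
  "submodule A M S \<longleftrightarrow> S \<subseteq> mcar M \<and> left_module A (M\<lparr>mcar := S\<rparr>)"

definition superfluous ::
  "('k::field, 'r::ab_group_add) kalg \<Rightarrow> ('r, 'm::ab_group_add) lmod \<Rightarrow> 'm set \<Rightarrow> bool" where
  "superfluous A M S \<longleftrightarrow> submodule A M S \<and>
     (\<forall>X. submodule A M X \<longrightarrow> {s + x |s x. s \<in> S \<and> x \<in> X} = mcar M \<longrightarrow> X = mcar M)"

definition indecomposable ::
  "('k::field, 'r::ab_group_add) kalg \<Rightarrow> ('r, 'm::ab_group_add) lmod \<Rightarrow> bool" where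
  "indecomposable A M \<longleftrightarrow> mcar M \<noteq> {0} \<and>
     (\<forall>S X. submodule A M S \<longrightarrow> submodule A M X \<longrightarrow>
        {s + x |s x. s \<in> S \<and> x \<in> X} = mcar M \<longrightarrow> S \<inter> X = {0} \<longrightarrow> S = {0} \<or> X = {0})"

text \<open>
  Projective objects of the category of finite dimensional modules. A finite dimensional module is
  isomorphic to one whose underlying space is some \<open>k^m\<close>, hence to one carried by a subset of
  \<^typ>\<open>nat \<Rightarrow> 'k\<close>; so it is enough to let the test modules \<open>X\<close>, \<open>Y\<close> range over such modules.
\<close>

definition projective ::
  "('k::field, 'r::ab_group_add) kalg \<Rightarrow> ('r, 'm::ab_group_add) lmod \<Rightarrow> bool" where
  "projective A P \<longleftrightarrow> fd_module A P \<and>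
     (\<forall>(X :: ('r, nat \<Rightarrow> 'k) lmod) (Y :: ('r, nat \<Rightarrow> 'k) lmod) g h.
        fd_module A X \<longrightarrow> fd_module A Y \<longrightarrow>
        lmod_hom X Y g \<longrightarrow> g ` mcar X = mcar Y \<longrightarrow> lmod_hom P Y h \<longrightarrow>
        (\<exists>l. lmod_hom P X l \<and> (\<forall>x\<in>mcar P. g (l x) = h x)))"

definition projective_cover ::
  "('k::field, 'r::ab_group_add) kalg \<Rightarrow> ('r, 'm::ab_group_add) lmod \<Rightarrow>
     ('r, 'n::ab_group_add) lmod \<Rightarrow> ('m \<Rightarrow> 'n) \<Rightarrow> bool" where
  "projective_cover A P M h \<longleftrightarrow> projective A P \<and> fd_module A M \<and>
     lmod_hom P M h \<and> h ` mcar P = mcar M \<and> superfluous A P {x \<in> mcar P. h x = 0}"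

text \<open>
  A resolution \<open>\<dots> \<rightarrow> P 2 \<rightarrow> P 1 \<rightarrow> P 0 \<rightarrow> M \<rightarrow> 0\<close> with augmentation \<open>d0 : P 0 \<rightarrow> M\<close> and
  \<open>d i : P i \<rightarrow> P (i - 1)\<close> for \<open>i \<ge> 1\<close> (\<open>d 0\<close> is not used). Exactness is contained in the
  requirement that each \<open>P (i + 1)\<close> is a projective cover of the preceding kernel.
\<close>

definition minimal_projective_resolution ::
  "('k::field, 'r::ab_group_add) kalg \<Rightarrow> (nat \<Rightarrow> ('r, 'p::ab_group_add) lmod) \<Rightarrow>
     (nat \<Rightarrow> 'p \<Rightarrow> 'p) \<Rightarrow> ('p \<Rightarrow> 'm) \<Rightarrow> ('r, 'm::ab_group_add) lmod \<Rightarrow> bool" where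
  "minimal_projective_resolution A P d d0 M \<longleftrightarrow>
     projective_cover A (P 0) M d0 \<and>
     projective_cover A (P 1) (kernel_module (P 0) d0) (d 1) \<and>
     (\<forall>i\<ge>1. projective_cover A (P (Suc i)) (kernel_module (P i) (d i)) (d (Suc i)))"

definition direct_sum ::
  "nat set \<Rightarrow> (nat \<Rightarrow> ('r, 'm::ab_group_add) lmod) \<Rightarrow> ('r, nat \<Rightarrow> 'm) lmod" where
  "direct_sum I N =
     \<lparr>mcar = {x. (\<forall>i\<in>I. x i \<in> mcar (N i)) \<and> (\<forall>i. i \<notin> I \<longrightarrow> x i = 0)},
      mact = (\<lambda>a x i. if i \<in> I then mact (N i) a (x i) else 0)\<rparr>"


section \<open>The algebra, its idempotents, the cocycle and the deformed algebra\<close>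

text \<open>
  The sort \<open>{ring, monoid_mult}\<close> is that of associative unital rings, without \<open>0 \<noteq> 1\<close>. The map
  \<open>A \<otimes> A \<rightarrow> A\<close> is given by the corresponding bilinear map, and likewise for
  \<open>A \<otimes> M\<^sub>0 \<rightarrow> M\<^sub>1\<close> below.
\<close>

definition algA :: "('k \<Rightarrow> 'a \<Rightarrow> 'a) \<Rightarrow> ('k, 'a::{ring,monoid_mult}) kalg" where
  "algA sc = \<lparr>ascale = sc, amult = (*), aone = 1\<rparr>"

definition primitive_idempotent :: "'a::{ring,monoid_mult} \<Rightarrow> bool" where
  "primitive_idempotent e \<longleftrightarrow> e * e = e \<and> e \<noteq> 0 \<and>
     (\<forall>x y. x * x = x \<longrightarrow> y * y = y \<longrightarrow> x * y = 0 \<longrightarrow> y * x = 0 \<longrightarrow> e = x + y \<longrightarrow> x = 0 \<or> y = 0)"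

definition Ae :: "'a::{ring,monoid_mult} \<Rightarrow> ('a, 'a) lmod" where
  "Ae e = \<lparr>mcar = {a * e |a. True}, mact = (*)\<rparr>"

definition basic_idempotents ::
  "('k::field \<Rightarrow> 'a \<Rightarrow> 'a) \<Rightarrow> nat \<Rightarrow> (nat \<Rightarrow> 'a::{ring,monoid_mult}) \<Rightarrow> bool" where
  "basic_idempotents sc n e \<longleftrightarrow>
     (\<Sum>i=1..n. e i) = 1 \<and>
     (\<forall>i\<in>{1..n}. primitive_idempotent (e i)) \<and>
     (\<forall>i\<in>{1..n}. \<forall>j\<in>{1..n}. i \<noteq> j \<longrightarrow> e i * e j = 0) \<and>
     (\<forall>i\<in>{1..n}. projective (algA sc) (Ae (e i)) \<and> indecomposable (algA sc) (Ae (e i))) \<and>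
     (\<forall>i\<in>{1..n}. \<forall>j\<in>{1..n}. lmod_isomorphic (Ae (e i)) (Ae (e j)) \<longrightarrow> i = j) \<and>
     (\<forall>P :: ('a, nat \<Rightarrow> 'k) lmod. projective (algA sc) P \<longrightarrow> indecomposable (algA sc) P \<longrightarrow>
        (\<exists>i\<in>{1..n}. lmod_isomorphic P (Ae (e i))))"

definition hochschild_2_cocycle ::
  "('k::field \<Rightarrow> 'a \<Rightarrow> 'a) \<Rightarrow> ('a \<Rightarrow> 'a \<Rightarrow> 'a::{ring,monoid_mult}) \<Rightarrow> bool" where
  "hochschild_2_cocycle sc f \<longleftrightarrow>
     (\<forall>a. Vector_Spaces.linear sc sc (\<lambda>b. f a b)) \<and>
     (\<forall>b. Vector_Spaces.linear sc sc (\<lambda>a. f a b)) \<and>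
     (\<forall>a b c. a * f b c - f (a * b) c + f a (b * c) - f a b * c = 0)"

text \<open>
  The pair \<open>(a, b)\<close> stands for \<open>a + b t\<close>. Since \<open>f\<close> is not assumed to be normalised, the unit is
  \<open>1 - f (1 \<otimes> 1) t\<close>.
\<close>

definition algAf ::
  "('k \<Rightarrow> 'a \<Rightarrow> 'a) \<Rightarrow> ('a \<Rightarrow> 'a \<Rightarrow> 'a) \<Rightarrow> ('k, 'a::{ring,monoid_mult} \<times> 'a) kalg" where
  "algAf sc f =
     \<lparr>ascale = (\<lambda>c (a, b). (sc c a, sc c b)),
      amult = (\<lambda>(a0, a1) (b0, b1). (a0 * b0, a0 * b1 + a1 * b0 + f a0 b0)),
      aone = (1, - f 1 1)\<rparr>"


section \<open>Modules over the deformed algebra as tuples\<close>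

record ('a, 'm, 'n) tup =
  tup0 :: "('a, 'm) lmod"
  tup1 :: "('a, 'n) lmod"
  tupT :: "'m \<Rightarrow> 'n"
  tupf :: "'a \<Rightarrow> 'm \<Rightarrow> 'n"

definition is_tuple ::
  "('k::field \<Rightarrow> 'a \<Rightarrow> 'a) \<Rightarrow> ('a \<Rightarrow> 'a \<Rightarrow> 'a) \<Rightarrow>
     ('a::{ring,monoid_mult}, 'm::ab_group_add, 'n::ab_group_add) tup \<Rightarrow> bool" where
  "is_tuple sc f M \<longleftrightarrow>
     fd_module (algA sc) (tup0 M) \<and> fd_module (algA sc) (tup1 M) \<and>
     lmod_hom (tup0 M) (tup1 M) (tupT M) \<and> inj_on (tupT M) (mcar (tup0 M)) \<and>
     (\<forall>a. k_linear (algA sc) (tup0 M) (tup1 M) (tupf M a)) \<and>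
     (\<forall>m\<in>mcar (tup0 M). \<forall>a b. tupf M (a + b) m = tupf M a m + tupf M b m) \<and>
     (\<forall>m\<in>mcar (tup0 M). \<forall>c a. tupf M (sc c a) m = kact (algA sc) (tup1 M) c (tupf M a m)) \<and>
     (\<forall>m\<in>mcar (tup0 M). \<forall>a b.
        mact (tup1 M) a (tupf M b m) - tupf M (a * b) m + tupf M a (mact (tup0 M) b m)
          - mact (tup1 M) (f a b) (tupT M m) = 0)"

definition tuple_module ::
  "('a, 'm, 'n::ab_group_add) tup \<Rightarrow> ('a \<times> 'a, 'm \<times> 'n) lmod" where
  "tuple_module M =
     \<lparr>mcar = mcar (tup0 M) \<times> mcar (tup1 M),
      mact = (\<lambda>(a, b) (m0, m1).
        (mact (tup0 M) a m0, mact (tup1 M) a m1 + mact (tup1 M) b (tupT M m0) + tupf M a m0))\<rparr>"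

definition is_triple ::
  "('k::field \<Rightarrow> 'a \<Rightarrow> 'a) \<Rightarrow>
     ('a::{ring,monoid_mult}, 'm0::ab_group_add, 'm1::ab_group_add) tup \<Rightarrow>
     ('a, 'n0::ab_group_add, 'n1::ab_group_add) tup \<Rightarrow>
     ('m0 \<Rightarrow> 'n0) \<times> ('m0 \<Rightarrow> 'n1) \<times> ('m1 \<Rightarrow> 'n1) \<Rightarrow> bool" where
  "is_triple sc M N = (\<lambda>(u0, u1, u2).
     lmod_hom (tup0 M) (tup0 N) u0 \<and> lmod_hom (tup1 M) (tup1 N) u2 \<and>
     k_linear (algA sc) (tup0 M) (tup1 N) u1 \<and>
     (\<forall>m\<in>mcar (tup0 M). tupT N (u0 m) = u2 (tupT M m)) \<and>
     (\<forall>a. \<forall>m\<in>mcar (tup0 M).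
        u1 (mact (tup0 M) a m) = mact (tup1 N) a (u1 m) - u2 (tupf M a m) + tupf N a (u0 m)))"

definition triple_map ::
  "('m0 \<Rightarrow> 'n0) \<times> ('m0 \<Rightarrow> 'n1) \<times> ('m1 \<Rightarrow> 'n1::ab_group_add) \<Rightarrow> 'm0 \<times> 'm1 \<Rightarrow> 'n0 \<times> 'n1" where
  "triple_map = (\<lambda>(u0, u1, u2) (m0, m1). (u0 m0, u1 m0 + u2 m1))"

definition zero_module :: "('a, 'm::ab_group_add) lmod" where
  "zero_module = \<lparr>mcar = {0}, mact = (\<lambda>_ _. 0)\<rparr>"

text \<open>The tuple \<open>(0, M, 0, 0)\<close>.\<close>

definition inflate :: "('a, 'm::ab_group_add) lmod \<Rightarrow> ('a, 'm, 'm) tup" where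
  "inflate M = \<lparr>tup0 = zero_module, tup1 = M, tupT = (\<lambda>_. 0), tupf = (\<lambda>_ _. 0)\<rparr>"

definition tuple_sum ::
  "nat set \<Rightarrow> (nat \<Rightarrow> ('a, 'm::ab_group_add, 'n::ab_group_add) tup) \<Rightarrow>
     ('a, nat \<Rightarrow> 'm, nat \<Rightarrow> 'n) tup" where
  "tuple_sum I X =
     \<lparr>tup0 = direct_sum I (\<lambda>i. tup0 (X i)),
      tup1 = direct_sum I (\<lambda>i. tup1 (X i)),
      tupT = (\<lambda>x i. if i \<in> I then tupT (X i) (x i) else 0),
      tupf = (\<lambda>a x i. if i \<in> I then tupf (X i) a (x i) else 0)\<rparr>"


section \<open>Projective modules with a decomposition\<close>

text \<open>
  A decomposed projective module is given by the list \<open>js = [i\<^sub>1, \<dots>, i\<^sub>m]\<close> of its indices; positions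
  are counted from 0. Matrices are functions of two indices, whose sizes are passed separately and
  outside of which the entries are irrelevant; a row vector is a one-row matrix.
\<close>

definition projQ :: "(nat \<Rightarrow> 'a::{ring,monoid_mult}) \<Rightarrow> nat list \<Rightarrow> ('a, nat \<Rightarrow> 'a) lmod" where
  "projQ e js = direct_sum {..<length js} (\<lambda>r. Ae (e (js ! r)))"

definition fQ ::
  "(nat \<Rightarrow> 'a::{ring,monoid_mult}) \<Rightarrow> ('a \<Rightarrow> 'a \<Rightarrow> 'a) \<Rightarrow> nat list \<Rightarrow>
     'a \<Rightarrow> (nat \<Rightarrow> 'a) \<Rightarrow> (nat \<Rightarrow> 'a)" where
  "fQ e f js a x = (\<lambda>r. if r < length js then f a (x r) * e (js ! r) else 0)"

definition hatQ ::
  "(nat \<Rightarrow> 'a::{ring,monoid_mult}) \<Rightarrow> ('a \<Rightarrow> 'a \<Rightarrow> 'a) \<Rightarrow> nat list \<Rightarrow>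
     ('a, nat \<Rightarrow> 'a, nat \<Rightarrow> 'a) tup" where
  "hatQ e f js = \<lparr>tup0 = projQ e js, tup1 = projQ e js, tupT = (\<lambda>x. x), tupf = fQ e f js\<rparr>"

text \<open>\<open>l\<close> is the inner dimension, i.e. the number of columns of \<open>B\<close> and of rows of \<open>B'\<close>.\<close>

definition matmul ::
  "nat \<Rightarrow> (nat \<Rightarrow> nat \<Rightarrow> 'a::{ring,monoid_mult}) \<Rightarrow> (nat \<Rightarrow> nat \<Rightarrow> 'a) \<Rightarrow> nat \<Rightarrow> nat \<Rightarrow> 'a" where
  "matmul l B B' i j = (\<Sum>k<l. B i k * B' k j)"

definition ftilde ::
  "('a \<Rightarrow> 'a \<Rightarrow> 'a) \<Rightarrow> nat \<Rightarrow> (nat \<Rightarrow> nat \<Rightarrow> 'a::{ring,monoid_mult}) \<Rightarrow> (nat \<Rightarrow> nat \<Rightarrow> 'a) \<Rightarrow>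
     nat \<Rightarrow> nat \<Rightarrow> 'a" where
  "ftilde f l B B' i j = (\<Sum>k<l. f (B i k) (B' k j))"

definition Emat :: "(nat \<Rightarrow> 'a::{ring,monoid_mult}) \<Rightarrow> nat list \<Rightarrow> nat \<Rightarrow> nat \<Rightarrow> 'a" where
  "Emat e js i j = (if i = j then e (js ! i) else 0)"

definition row :: "(nat \<Rightarrow> 'a) \<Rightarrow> nat \<Rightarrow> nat \<Rightarrow> 'a" where
  "row x = (\<lambda>_. x)"

definition is_matrix_of ::
  "(nat \<Rightarrow> 'a::{ring,monoid_mult}) \<Rightarrow> nat list \<Rightarrow> nat list \<Rightarrow> (nat \<Rightarrow> nat \<Rightarrow> 'a) \<Rightarrow>
     ((nat \<Rightarrow> 'a) \<Rightarrow> (nat \<Rightarrow> 'a)) \<Rightarrow> bool" where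
  "is_matrix_of e js js' B d \<longleftrightarrow>
     (\<forall>r<length js. \<forall>s<length js'.
        matmul (length js') (matmul (length js) (Emat e js) B) (Emat e js') r s = B r s) \<and>
     (\<forall>x\<in>mcar (projQ e js). \<forall>s<length js'. d x s = matmul (length js) (row x) B 0 s)"

definition Tdelta ::
  "(nat \<Rightarrow> 'a::{ring,monoid_mult}) \<Rightarrow> ('a \<Rightarrow> 'a \<Rightarrow> 'a) \<Rightarrow> nat list \<Rightarrow> nat list \<Rightarrow>
     (nat \<Rightarrow> nat \<Rightarrow> 'a) \<Rightarrow> (nat \<Rightarrow> 'a) \<Rightarrow> (nat \<Rightarrow> 'a)" where
  "Tdelta e f js js' B x =
     (\<lambda>s. if s < length js'
          then matmul (length js') (ftilde f (length js) (row x) B) (Emat e js') 0 s else 0)"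

text \<open>
  The data \<open>js\<close>, \<open>\<delta>\<close>, \<open>\<delta>0\<close> form a minimal projective resolution witnessing the condition \<open>(*A)\<close>
  for \<open>M\<close>, with \<open>Q\<^sub>i\<close> given by the list \<open>js i\<close>. Every homomorphism
  between decomposed projective modules has exactly one matrix \<open>B\<close> (up to irrelevant entries).
\<close>

definition starA_resolution ::
  "('k::field \<Rightarrow> 'a \<Rightarrow> 'a) \<Rightarrow> nat \<Rightarrow> (nat \<Rightarrow> 'a::{ring,monoid_mult}) \<Rightarrow> ('a \<Rightarrow> 'a \<Rightarrow> 'a) \<Rightarrow>
     (nat \<Rightarrow> nat list) \<Rightarrow> (nat \<Rightarrow> (nat \<Rightarrow> 'a) \<Rightarrow> (nat \<Rightarrow> 'a)) \<Rightarrow> ((nat \<Rightarrow> 'a) \<Rightarrow> 'm) \<Rightarrow>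
     ('a, 'm::ab_group_add) lmod \<Rightarrow> bool" where
  "starA_resolution sc n e f js \<delta> \<delta>0 M \<longleftrightarrow>
     (\<forall>i. set (js i) \<subseteq> {1..n}) \<and>
     minimal_projective_resolution (algA sc) (\<lambda>i. projQ e (js i)) \<delta> \<delta>0 M \<and>
     (\<exists>B. is_matrix_of e (js 1) (js 0) B (\<delta> 1) \<and>
          (\<forall>x\<in>mcar (projQ e (js 1)). \<delta>0 (Tdelta e f (js 1) (js 0) B x) = 0))"


section \<open>The resolution over the deformed algebra\<close>

definition sign_power :: "nat \<Rightarrow> 'm::ab_group_add \<Rightarrow> 'm" where
  "sign_power j x = (if even j then x else - x)"

definition Phat ::
  "(nat \<Rightarrow> 'a::{ring,monoid_mult}) \<Rightarrow> ('a \<Rightarrow> 'a \<Rightarrow> 'a) \<Rightarrow> (nat \<Rightarrow> nat list) \<Rightarrow> nat \<Rightarrow>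
     ('a, nat \<Rightarrow> nat \<Rightarrow> 'a, nat \<Rightarrow> nat \<Rightarrow> 'a) tup" where
  "Phat e f js m = tuple_sum {0..m} (\<lambda>i. hatQ e f (js i))"

text \<open>The component in \<open>Q\<^sub>i\<^sub>-\<^sub>1\<close>, for \<open>1 \<le> i \<le> m\<close>, is the one with number \<open>j = i - 1 < m\<close>.\<close>

definition umap :: "(nat \<Rightarrow> 'q \<Rightarrow> 'q::ab_group_add) \<Rightarrow> nat \<Rightarrow> (nat \<Rightarrow> 'q) \<Rightarrow> (nat \<Rightarrow> 'q)" where
  "umap \<delta> m x = (\<lambda>j. if j < m then \<delta> (j + 1) (x (j + 1)) else 0)"

definition vmap :: "(nat \<Rightarrow> 'q \<Rightarrow> 'q::ab_group_add) \<Rightarrow> nat \<Rightarrow> (nat \<Rightarrow> 'q) \<Rightarrow> (nat \<Rightarrow> 'q)" where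
  "vmap T m x = (\<lambda>j. if j < m then sign_power j (x j + T (j + 1) (x (j + 1))) else 0)"

definition hat_delta ::
  "(nat \<Rightarrow> 'q \<Rightarrow> 'q::ab_group_add) \<Rightarrow> (nat \<Rightarrow> 'q \<Rightarrow> 'q) \<Rightarrow> nat \<Rightarrow>
     ((nat \<Rightarrow> 'q) \<Rightarrow> (nat \<Rightarrow> 'q)) \<times> ((nat \<Rightarrow> 'q) \<Rightarrow> (nat \<Rightarrow> 'q)) \<times> ((nat \<Rightarrow> 'q) \<Rightarrow> (nat \<Rightarrow> 'q))" where
  "hat_delta \<delta> T m = (umap \<delta> m, vmap T m, umap \<delta> m)"

text \<open>The sum \<^term>\<open>Phat e f js 0\<close> has the single summand \<open>hatQ e f (js 0)\<close>, at position 0.\<close>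

definition hat_delta0 ::
  "('q \<Rightarrow> 'm::ab_group_add) \<Rightarrow>
     ((nat \<Rightarrow> 'q) \<Rightarrow> 'm) \<times> ((nat \<Rightarrow> 'q) \<Rightarrow> 'm) \<times> ((nat \<Rightarrow> 'q) \<Rightarrow> 'm)" where
  "hat_delta0 \<delta>0 = ((\<lambda>_. 0), (\<lambda>x. \<delta>0 (x 0)), (\<lambda>_. 0))"

end

theory Submission
  imports Defs
begin

text \<open>
  Write \<open>K\<^sub>0 = ker \<delta>\<^sub>0\<close> and \<open>K\<^sub>i = ker \<delta>\<^sub>i = im \<delta>\<^sub>i\<^sub>+\<^sub>1\<close> for the syzygies of \<open>M\<close>.

  The twisted condition on \<open>T\<^sub>i\<close> is inhomogeneous and linear. The cocycle identity makes
  \<open>\<plusminus>T\<^sub>\<delta>\<close>, computed from a matrix of \<open>\<delta>\<^sub>i\<close>, a particular solution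
  (\<open>Tdelta_twisted\<close>), and any two solutions differ by a homomorphism. Starting from \<open>T\<^sub>1 = T\<^sub>\<delta>\<close>, one
  corrects the particular solution for \<open>T\<^sub>i\<^sub>+\<^sub>1\<close> by lifting the defect
  \<open>T\<^sub>i \<delta>\<^sub>i\<^sub>+\<^sub>1 - \<delta>\<^sub>i T\<^sub>i\<^sub>+\<^sub>1\<close>, which is a homomorphism into \<open>K\<^sub>i\<^sub>-\<^sub>1\<close>, along \<open>\<delta>\<^sub>i\<close>
  (\<open>twisted_extend\<close>). The induction carries the invariant that \<open>T\<^sub>i\<close> maps \<open>K\<^sub>i\<close> into \<open>K\<^sub>i\<^sub>-\<^sub>1\<close>, which
  puts the next defect into a syzygy; for \<open>i = 1\<close> it follows from condition \<open>(\<ast>A)\<close>.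

  The tuples \<open>(Q, Q, Id, f\<^sub>Q)\<close> are projective because idempotents of \<open>A\<close> lift along the nilpotent
  ideal \<open>At\<close>. This is used in the explicit form of a dual basis (\<open>dual_basis_P\<close>), and the same
  device gives liftings for the modules \<open>Q\<^sub>i\<close> themselves.

  Exactness is a direct computation: a cycle \<open>(x, y)\<close> of degree \<open>m\<close> is the image of some \<open>(z, 0)\<close>,
  where \<open>z\<^sub>m\<^sub>+\<^sub>1\<close> is a preimage of \<open>x\<^sub>m\<close> and the other components are determined downwards by \<open>y\<close>
  (\<open>cycles_subset_image\<close>).

  For minimality, let \<open>(x, y)\<close> be a cycle. Then every \<open>x\<^sub>i\<close> lies in \<open>K\<^sub>i\<close>, again by the
  invariant of the \<open>T\<^sub>i\<close>, and the sum of the \<open>K\<^sub>i\<close> is superfluous in the sum of the \<open>Q\<^sub>i\<close>. It is enough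
  to control the first components, since the elements \<open>(0, y)\<close> are multiples of the nilpotent
  element \<open>t\<close> (\<open>superfluous_tuple\<close>).
\<close>


section \<open>Generalities on modules\<close>

lemma sum_fun_apply: "(\<Sum>i\<in>I. g i) j = (\<Sum>i\<in>I. g i j)"
  for g :: "'i \<Rightarrow> 'j \<Rightarrow> 'b::comm_monoid_add"
  by (induction I rule: infinite_finite_induct) auto

lemma additive_on_zero:
  fixes h :: "'m::ab_group_add \<Rightarrow> 'n::ab_group_add"
  assumes "0 \<in> S" and "\<And>x y. x \<in> S \<Longrightarrow> y \<in> S \<Longrightarrow> h (x + y) = h x + h y"
  shows "h 0 = 0"
  using assms(2)[OF assms(1) assms(1)] by simp

context left_module
begin

lemma act_zero_right [simp]: "mact M a 0 = 0"
  by (rule additive_on_zero[OF zero_closed]) (rule act_add_right)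

lemma act_zero_left [simp]: "x \<in> mcar M \<Longrightarrow> mact M 0 x = 0"
  by (rule additive_on_zero[of UNIV]) (auto simp: act_add_left)

lemma act_minus_right: "x \<in> mcar M \<Longrightarrow> mact M a (- x) = - mact M a x"
  using act_add_right[of x "- x" a] by (simp add: minus_closed eq_neg_iff_add_eq_0 add.commute)

lemma act_minus_left: "x \<in> mcar M \<Longrightarrow> mact M (- a) x = - mact M a x"
  using act_add_left[of x a "- a"] by (simp add: eq_neg_iff_add_eq_0 add.commute)

lemma diff_closed: "x \<in> mcar M \<Longrightarrow> y \<in> mcar M \<Longrightarrow> x - y \<in> mcar M"
  using add_closed[of x "- y"] minus_closed[of y] by simp

lemma act_diff_right:
  "x \<in> mcar M \<Longrightarrow> y \<in> mcar M \<Longrightarrow> mact M a (x - y) = mact M a x - mact M a y"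
  using act_add_right[of x "- y" a] by (simp add: minus_closed act_minus_right)

lemma sum_closed: "(\<And>i. i \<in> I \<Longrightarrow> g i \<in> mcar M) \<Longrightarrow> (\<Sum>i\<in>I. g i) \<in> mcar M"
  by (induction I rule: infinite_finite_induct) (auto intro: zero_closed add_closed)

lemma act_sum_right:
  "(\<And>i. i \<in> I \<Longrightarrow> g i \<in> mcar M) \<Longrightarrow> mact M a (\<Sum>i\<in>I. g i) = (\<Sum>i\<in>I. mact M a (g i))"
  by (induction I rule: infinite_finite_induct) (auto simp: act_add_right sum_closed)

lemma additive_sum:
  fixes h :: "'m \<Rightarrow> 'n::ab_group_add"
  assumes "\<And>x y. x \<in> mcar M \<Longrightarrow> y \<in> mcar M \<Longrightarrow> h (x + y) = h x + h y"
    and "\<And>i. i \<in> I \<Longrightarrow> g i \<in> mcar M"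
  shows "h (\<Sum>i\<in>I. g i) = (\<Sum>i\<in>I. h (g i))"
  using assms(2)
  by (induction I rule: infinite_finite_induct)
     (auto simp: assms(1) sum_closed additive_on_zero[OF zero_closed assms(1)])

lemma additive_minus:
  fixes h :: "'m \<Rightarrow> 'n::ab_group_add"
  assumes "\<And>x y. x \<in> mcar M \<Longrightarrow> y \<in> mcar M \<Longrightarrow> h (x + y) = h x + h y" and "x \<in> mcar M"
  shows "h (- x) = - h x"
  using assms(1)[of x "- x"] additive_on_zero[OF zero_closed assms(1)] assms(2)
  by (simp add: minus_closed eq_neg_iff_add_eq_0 add.commute)

lemma additive_diff:
  fixes h :: "'m \<Rightarrow> 'n::ab_group_add"
  assumes "\<And>x y. x \<in> mcar M \<Longrightarrow> y \<in> mcar M \<Longrightarrow> h (x + y) = h x + h y"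
    and "x \<in> mcar M" "y \<in> mcar M"
  shows "h (x - y) = h x - h y"
  using assms(1)[of x "- y"] additive_minus[of h, OF assms(1) assms(3)] assms(2,3)
  by (simp add: minus_closed)

end

lemma lmod_homD:
  assumes "lmod_hom M N h"
  shows "x \<in> mcar M \<Longrightarrow> h x \<in> mcar N"
    and "x \<in> mcar M \<Longrightarrow> y \<in> mcar M \<Longrightarrow> h (x + y) = h x + h y"
    and "x \<in> mcar M \<Longrightarrow> h (mact M a x) = mact N a (h x)"
  using assms by (auto simp: lmod_hom_def)

lemma lmod_homI:
  assumes "\<And>x. x \<in> mcar M \<Longrightarrow> h x \<in> mcar N"
    and "\<And>x y. x \<in> mcar M \<Longrightarrow> y \<in> mcar M \<Longrightarrow> h (x + y) = h x + h y"
    and "\<And>a x. x \<in> mcar M \<Longrightarrow> h (mact M a x) = mact N a (h x)"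
  shows "lmod_hom M N h"
  using assms by (auto simp: lmod_hom_def)

lemma k_linearD:
  assumes "k_linear A M N h"
  shows "x \<in> mcar M \<Longrightarrow> h x \<in> mcar N"
    and "x \<in> mcar M \<Longrightarrow> y \<in> mcar M \<Longrightarrow> h (x + y) = h x + h y"
    and "x \<in> mcar M \<Longrightarrow> h (kact A M c x) = kact A N c (h x)"
  using assms by (auto simp: k_linear_def)

lemma k_linearI:
  assumes "\<And>x. x \<in> mcar M \<Longrightarrow> h x \<in> mcar N"
    and "\<And>x y. x \<in> mcar M \<Longrightarrow> y \<in> mcar M \<Longrightarrow> h (x + y) = h x + h y"
    and "\<And>c x. x \<in> mcar M \<Longrightarrow> h (kact A M c x) = kact A N c (h x)"
  shows "k_linear A M N h"
  using assms by (auto simp: k_linear_def)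

lemma lmod_hom_k_linear: "lmod_hom M N h \<Longrightarrow> k_linear A M N h"
  by (auto simp: lmod_hom_def k_linear_def kact_def)

lemma k_linear_add:
  assumes "left_module A N" "k_linear A M N g" "k_linear A M N h"
  shows "k_linear A M N (\<lambda>x. g x + h x)"
  using assms(2,3)
  by (intro k_linearI)
     (auto simp: k_linear_def kact_def left_module.add_closed[OF assms(1)]
        left_module.act_add_right[OF assms(1)])

lemma k_linear_minus:
  assumes "left_module A N" "k_linear A M N g"
  shows "k_linear A M N (\<lambda>x. - g x)"
  using assms(2)
  by (intro k_linearI)
     (auto simp: k_linear_def kact_def left_module.minus_closed[OF assms(1)]
        left_module.act_minus_right[OF assms(1)])

lemma submoduleI:
  assumes "left_module A M" and sub: "S \<subseteq> mcar M" and "0 \<in> S"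
    and add: "\<And>x y. x \<in> S \<Longrightarrow> y \<in> S \<Longrightarrow> x + y \<in> S"
    and act: "\<And>a x. x \<in> S \<Longrightarrow> mact M a x \<in> S"
  shows "submodule A M S"
proof -
  interpret left_module A M by fact
  have "left_module A (M\<lparr>mcar := S\<rparr>)"
  proof
    fix x assume x: "x \<in> mcar (M\<lparr>mcar := S\<rparr>)"
    \<comment> \<open>Closure under negation comes from the action of \<open>- 1\<close>.\<close>
    have "mact M (- aone A) x = - x"
      using x sub by (simp add: subset_iff act_minus_left act_one)
    then show "- x \<in> mcar (M\<lparr>mcar := S\<rparr>)" using act[of x "- aone A"] x by simp
  qed (use assms in \<open>auto simp: subset_iff act_add_right act_add_left act_mult act_one\<close>)
  with sub show ?thesis by (simp add: submodule_def)
qed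

subsection \<open>Finite dimension\<close>

lemma kact_add_scalar:
  assumes "left_module A M" "vector_space (ascale A)" "x \<in> mcar M"
  shows "kact A M (c + d) x = kact A M c x + kact A M d x"
  by (simp add: kact_def vector_space.vector_space_assms(2)[OF assms(2)]
      left_module.act_add_left[OF assms(1,3)])

text \<open>
  The definition of finite dimension asks for a spanning set; this form lets one give a spanning
  family instead, whose members may coincide.
\<close>

lemma fd_moduleI:
  assumes M: "left_module A M" and vs: "vector_space (ascale A)" and I: "finite I"
    and g: "\<And>i. i \<in> I \<Longrightarrow> g i \<in> mcar M"
    and span: "\<And>x. x \<in> mcar M \<Longrightarrow> \<exists>c. x = (\<Sum>i\<in>I. kact A M (c i) (g i))"
  shows "fd_module A M"
proof -
  have "\<exists>c. x = (\<Sum>b\<in>g ` I. kact A M (c b) b)" if x: "x \<in> mcar M" for x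
  proof -
    obtain c where c: "x = (\<Sum>i\<in>I. kact A M (c i) (g i))" using span[OF x] by blast
    have collect: "kact A M (\<Sum>i\<in>J. c i) b = (\<Sum>i\<in>J. kact A M (c i) b)"
      if "b \<in> mcar M" for b J
    proof -
      have zero: "kact A M 0 b = 0"
        using kact_add_scalar[OF M vs that, of 0 0] by simp
      show ?thesis
        by (induction J rule: infinite_finite_induct)
           (auto simp: zero kact_add_scalar[OF M vs that])
    qed
    have "x = (\<Sum>b\<in>g ` I. \<Sum>i\<in>{i \<in> I. g i = b}. kact A M (c i) (g i))"
      unfolding c by (rule sum.image_gen[OF I])
    also have "\<dots> = (\<Sum>b\<in>g ` I. kact A M (\<Sum>i\<in>{i \<in> I. g i = b}. c i) b)"
      using g by (intro sum.cong) (auto simp: collect)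
    finally show ?thesis by (rule exI[where x = "\<lambda>b. \<Sum>i\<in>{i \<in> I. g i = b}. c i"])
  qed
  then show ?thesis
    unfolding fd_module_def using M I g by (intro conjI exI[of _ "g ` I"]) auto
qed

text \<open>
  The kernels in the resolution are images of its terms, so that their finite dimension follows
  without a dimension theory for subspaces.
\<close>

lemma fd_module_image:
  assumes P: "fd_module A P" and N: "left_module A N" and vs: "vector_space (ascale A)"
    and h: "lmod_hom P N h" "h ` mcar P = mcar N"
  shows "fd_module A N"
proof -
  obtain B where B: "finite B" "B \<subseteq> mcar P"
    "\<And>x. x \<in> mcar P \<Longrightarrow> \<exists>c. x = (\<Sum>b\<in>B. kact A P (c b) b)" and LP: "left_module A P"
    using P unfolding fd_module_def by blast
  interpret P: left_module A P by fact
  show ?thesis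
  proof (rule fd_moduleI[OF N vs B(1), of h])
    show "h b \<in> mcar N" if "b \<in> B" for b using that B(2) lmod_homD(1)[OF h(1)] by auto
  next
    fix y assume "y \<in> mcar N"
    then obtain x where x: "x \<in> mcar P" "y = h x" using h(2) by auto
    obtain c where c: "x = (\<Sum>b\<in>B. kact A P (c b) b)" using B(3)[OF x(1)] by blast
    have "y = (\<Sum>b\<in>B. h (kact A P (c b) b))"
      unfolding x(2) c
      by (rule P.additive_sum) (use B(2) lmod_homD(2)[OF h(1)] in \<open>auto simp: kact_def P.act_closed\<close>)
    also have "\<dots> = (\<Sum>b\<in>B. kact A N (c b) (h b))"
      using B(2) lmod_homD(3)[OF h(1)] by (intro sum.cong) (auto simp: kact_def)
    finally show "\<exists>c. y = (\<Sum>b\<in>B. kact A N (c b) (h b))" by blast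
  qed
qed

subsection \<open>Superfluous submodules\<close>

lemma submodule_self: "left_module A M \<Longrightarrow> submodule A M (mcar M)"
  by (cases M) (simp add: submodule_def)

lemma submodule_add:
  assumes "left_module A M" "submodule A M S" "submodule A M S'"
  shows "submodule A M {s + s' |s s'. s \<in> S \<and> s' \<in> S'}"
proof -
  interpret M: left_module A M by fact
  interpret S: left_module A "M\<lparr>mcar := S\<rparr>" using assms(2) by (simp add: submodule_def)
  interpret S': left_module A "M\<lparr>mcar := S'\<rparr>" using assms(3) by (simp add: submodule_def)
  have sub: "S \<subseteq> mcar M" "S' \<subseteq> mcar M" using assms by (auto simp: submodule_def)
  show ?thesis
    proof (rule submoduleI[OF assms(1)])
    show "{s + s' |s s'. s \<in> S \<and> s' \<in> S'} \<subseteq> mcar M"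
      using sub M.add_closed by blast
    show "0 \<in> {s + s' |s s'. s \<in> S \<and> s' \<in> S'}"
      using S.zero_closed S'.zero_closed by force
  next
    fix x y assume "x \<in> {s + s' |s s'. s \<in> S \<and> s' \<in> S'}" "y \<in> {s + s' |s s'. s \<in> S \<and> s' \<in> S'}"
    then obtain s s' r r' where "x = s + s'" "y = r + r'" "s \<in> S" "r \<in> S" "s' \<in> S'" "r' \<in> S'"
      by blast
    then show "x + y \<in> {s + s' |s s'. s \<in> S \<and> s' \<in> S'}"
      using S.add_closed[of s r] S'.add_closed[of s' r']
      by (intro CollectI exI[of _ "s + r"] exI[of _ "s' + r'"]) (simp add: ac_simps)
  next
    fix a x assume "x \<in> {s + s' |s s'. s \<in> S \<and> s' \<in> S'}"
    then obtain s s' where s: "x = s + s'" "s \<in> S" "s' \<in> S'" by blast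
    then have "mact M a x = mact M a s + mact M a s'" using sub by (simp add: M.act_add_right subset_iff)
    then show "mact M a x \<in> {s + s' |s s'. s \<in> S \<and> s' \<in> S'}"
      using S.act_closed[of s a] S'.act_closed[of s' a] s by auto
  qed
qed

lemma superfluousI:
  assumes "submodule A M S"
    and "\<And>X. submodule A M X \<Longrightarrow> (\<And>z. z \<in> mcar M \<Longrightarrow> \<exists>s\<in>S. \<exists>x\<in>X. z = s + x) \<Longrightarrow> mcar M \<subseteq> X"
  shows "superfluous A M S"
  unfolding superfluous_def
proof (intro conjI allI impI assms(1))
  fix X assume X: "submodule A M X" and eq: "{s + x |s x. s \<in> S \<and> x \<in> X} = mcar M"
  show "X = mcar M"
    using assms(2)[OF X] eq X unfolding submodule_def by blast
qed

lemma superfluousD: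
  assumes "left_module A M" "superfluous A M S" "submodule A M X"
    and "\<And>z. z \<in> mcar M \<Longrightarrow> \<exists>s\<in>S. \<exists>x\<in>X. z = s + x"
  shows "X = mcar M"
proof -
  have "S \<subseteq> mcar M" "X \<subseteq> mcar M" using assms(2,3) by (auto simp: superfluous_def submodule_def)
  then have "{s + x |s x. s \<in> S \<and> x \<in> X} = mcar M"
    using assms(4) left_module.add_closed[OF assms(1)] by blast
  then show ?thesis using assms(2,3) by (auto simp: superfluous_def)
qed

lemma superfluous_add:
  assumes M: "left_module A M" and S: "superfluous A M S" and S': "superfluous A M S'"
  shows "superfluous A M {s + s' |s s'. s \<in> S \<and> s' \<in> S'}"
proof (rule superfluousI)
  show "submodule A M {s + s' |s s'. s \<in> S \<and> s' \<in> S'}"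
    using S S' by (intro submodule_add[OF M]) (auto simp: superfluous_def)
next
  fix X assume X: "submodule A M X"
    and dec: "\<And>z. z \<in> mcar M \<Longrightarrow> \<exists>s\<in>{s + s' |s s'. s \<in> S \<and> s' \<in> S'}. \<exists>x\<in>X. z = s + x"
  have "{s' + x |s' x. s' \<in> S' \<and> x \<in> X} = mcar M"
  proof (rule superfluousD[OF M S])
    show "submodule A M {s' + x |s' x. s' \<in> S' \<and> x \<in> X}"
      using S' X by (intro submodule_add[OF M]) (auto simp: superfluous_def)
  next
    fix z assume "z \<in> mcar M"
    then obtain s s' x where "s \<in> S" "s' \<in> S'" "x \<in> X" "z = (s + s') + x" using dec by blast
    then show "\<exists>s\<in>S. \<exists>y\<in>{s' + x |s' x. s' \<in> S' \<and> x \<in> X}. z = s + y"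
      by (auto simp: add.assoc)
  qed
  then have "X = mcar M"
    by (intro superfluousD[OF M S' X]) blast
  then show "mcar M \<subseteq> X" by simp
qed

lemma submodule_image:
  assumes N: "left_module A N" and M: "left_module A M" and h: "lmod_hom N M h"
    and S: "submodule A N S"
  shows "submodule A M (h ` S)"
proof -
  interpret N: left_module A N by fact
  interpret S: left_module A "N\<lparr>mcar := S\<rparr>" using S by (simp add: submodule_def)
  have sub: "S \<subseteq> mcar N" using S by (simp add: submodule_def)
  have h0: "h 0 = 0" by (rule additive_on_zero[OF N.zero_closed lmod_homD(2)[OF h]])
  show "submodule A M (h ` S)"
  proof (rule submoduleI[OF M])
    show "h ` S \<subseteq> mcar M" using sub lmod_homD(1)[OF h] by auto
    show "0 \<in> h ` S" using S.zero_closed h0 by (auto intro: image_eqI[of _ _ 0])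
  next
    fix x y assume "x \<in> h ` S" "y \<in> h ` S"
    then obtain s s' where s: "s \<in> S" "x = h s" "s' \<in> S" "y = h s'" by auto
    then have "x + y = h (s + s')" using sub by (simp add: lmod_homD(2)[OF h] subset_iff)
    then show "x + y \<in> h ` S" using s S.add_closed[of s s'] by auto
  next
    fix a x assume "x \<in> h ` S"
    then obtain s where s: "s \<in> S" "x = h s" by auto
    then show "mact M a x \<in> h ` S"
      using sub lmod_homD(3)[OF h, of s a] S.act_closed[of s a] by (intro image_eqI[of _ h "mact N a s"]) auto
  qed
qed

lemma superfluous_image:
  assumes N: "left_module A N" and M: "left_module A M" and h: "lmod_hom N M h"
    and S: "superfluous A N S"
  shows "superfluous A M (h ` S)"
proof (rule superfluousI)
  interpret N: left_module A N by fact
  have sub: "S \<subseteq> mcar N" using S by (simp add: superfluous_def submodule_def)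
  have h0: "h 0 = 0" by (rule additive_on_zero[OF N.zero_closed lmod_homD(2)[OF h]])
  show "submodule A M (h ` S)"
    using S by (intro submodule_image[OF N M h]) (simp add: superfluous_def)
  fix X assume X: "submodule A M X"
    and dec: "\<And>z. z \<in> mcar M \<Longrightarrow> \<exists>s\<in>h ` S. \<exists>x\<in>X. z = s + x"
  interpret X: left_module A "M\<lparr>mcar := X\<rparr>" using X by (simp add: submodule_def)
  have "{y \<in> mcar N. h y \<in> X} = mcar N"
  proof (rule superfluousD[OF N S])
    show "submodule A N {y \<in> mcar N. h y \<in> X}"
      using X.zero_closed X.add_closed X.act_closed h0
      by (intro submoduleI[OF N])
         (auto simp: lmod_homD[OF h] N.zero_closed N.add_closed N.act_closed)
  next
    fix z assume z: "z \<in> mcar N"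
    then obtain s x where s: "s \<in> S" "x \<in> X" "h z = h s + x" using dec[of "h z"] lmod_homD(1)[OF h] by auto
    have "h (z - s) = x" using N.additive_diff[of h, OF lmod_homD(2)[OF h] z] s sub by auto
    then show "\<exists>s\<in>S. \<exists>y\<in>{y \<in> mcar N. h y \<in> X}. z = s + y"
      using s sub z N.diff_closed by (intro bexI[of _ s] bexI[of _ "z - s"]) auto
  qed
  then have "h ` S \<subseteq> X" using sub by blast
  show "mcar M \<subseteq> X"
  proof
    fix z assume "z \<in> mcar M"
    then obtain s x where "s \<in> S" "x \<in> X" "z = h s + x" using dec[of z] by blast
    then show "z \<in> X" using X.add_closed[of "h s" x] \<open>h ` S \<subseteq> X\<close> by auto
  qed
qed

lemma superfluous_zero:
  assumes "left_module A M"
  shows "superfluous A M {0}"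
proof (rule superfluousI)
  show "submodule A M {0}"
    by (rule submoduleI[OF assms])
       (auto simp: left_module.zero_closed[OF assms] left_module.act_zero_right[OF assms])
qed auto

subsection \<open>Direct sums\<close>

definition single :: "nat \<Rightarrow> 'm::zero \<Rightarrow> nat \<Rightarrow> 'm" where
  "single i x = (\<lambda>j. if j = i then x else 0)"

lemma direct_sum_simps [simp]:
  "mcar (direct_sum I N) = {x. (\<forall>i\<in>I. x i \<in> mcar (N i)) \<and> (\<forall>i. i \<notin> I \<longrightarrow> x i = 0)}"
  "mact (direct_sum I N) = (\<lambda>a x i. if i \<in> I then mact (N i) a (x i) else 0)"
  by (simp_all add: direct_sum_def)

lemma left_module_direct_sum:
  assumes "\<And>i. i \<in> I \<Longrightarrow> left_module A (N i)"
  shows "left_module A (direct_sum I N)"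
  by standard
     (auto simp: fun_eq_iff left_module.zero_closed[OF assms] left_module.add_closed[OF assms]
        left_module.minus_closed[OF assms] left_module.act_closed[OF assms]
        left_module.act_add_right[OF assms] left_module.act_add_left[OF assms]
        left_module.act_mult[OF assms] left_module.act_one[OF assms])

lemma single_hom:
  assumes "\<And>i. i \<in> I \<Longrightarrow> left_module A (N i)" "i \<in> I"
  shows "lmod_hom (N i) (direct_sum I N) (single i)"
  using assms left_module.zero_closed left_module.act_zero_right
  by (intro lmod_homI) (fastforce simp: single_def fun_eq_iff)+

lemma sum_single:
  assumes "finite I" "\<And>i. i \<notin> I \<Longrightarrow> x i = 0"
  shows "x = (\<Sum>i\<in>I. single i (x i))"
proof
  fix j
  show "x j = (\<Sum>i\<in>I. single i (x i)) j"
    using assms by (cases "j \<in> I") (auto simp: sum_fun_apply single_def)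
qed

lemma fd_module_direct_sum:
  assumes vs: "vector_space (ascale A)" and I: "finite I"
    and fd: "\<And>i. i \<in> I \<Longrightarrow> fd_module A (N i)"
  shows "fd_module A (direct_sum I N)"
proof -
  have LM: "left_module A (N i)" if "i \<in> I" for i using fd[OF that] by (simp add: fd_module_def)
  have "\<exists>B. finite B \<and> B \<subseteq> mcar (N i) \<and> (\<forall>x\<in>mcar (N i). \<exists>c. x = (\<Sum>b\<in>B. kact A (N i) (c b) b))"
    if "i \<in> I" for i using fd[OF that] by (simp add: fd_module_def)
  then obtain B where B: "\<And>i. i \<in> I \<Longrightarrow> finite (B i)" "\<And>i. i \<in> I \<Longrightarrow> B i \<subseteq> mcar (N i)"
    "\<And>i x. i \<in> I \<Longrightarrow> x \<in> mcar (N i) \<Longrightarrow> \<exists>c. x = (\<Sum>b\<in>B i. kact A (N i) (c b) b)"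
    by metis
  show ?thesis
  proof (rule fd_moduleI[OF left_module_direct_sum[OF LM] vs, where I = "Sigma I B" and g = "\<lambda>(i, b). single i b"])
    show "finite (Sigma I B)" using I B(1) by auto
    show "(case p of (i, b) \<Rightarrow> single i b) \<in> mcar (direct_sum I N)" if "p \<in> Sigma I B" for p
      using that by (auto simp: single_def left_module.zero_closed[OF LM] dest: subsetD[OF B(2)])
  next
    fix x assume x: "x \<in> mcar (direct_sum I N)"
    then have "\<forall>i\<in>I. \<exists>c. x i = (\<Sum>b\<in>B i. kact A (N i) (c b) b)" using B(3) by simp
    then obtain c where c: "\<And>i. i \<in> I \<Longrightarrow> x i = (\<Sum>b\<in>B i. kact A (N i) (c i b) b)" by metis
    have "x = (\<Sum>i\<in>I. single i (x i))" using x by (intro sum_single I) auto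
    also have "\<dots> = (\<Sum>i\<in>I. \<Sum>b\<in>B i. kact A (direct_sum I N) (c i b) (single i b))"
    proof (rule sum.cong[OF refl])
      fix i assume i: "i \<in> I"
      interpret left_module A "N i" by (rule LM[OF i])
      note hom = single_hom[of I A N, OF LM i]
      have "single i (x i) = (\<Sum>b\<in>B i. single i (kact A (N i) (c i b) b))"
        unfolding c[OF i]
        by (rule additive_sum) (use hom B(2)[OF i] in \<open>auto simp: lmod_homD(2) kact_def act_closed\<close>)
      also have "\<dots> = (\<Sum>b\<in>B i. kact A (direct_sum I N) (c i b) (single i b))"
        using B(2)[OF i] lmod_homD(3)[OF hom]
        by (intro sum.cong) (auto simp: kact_def)
      finally show "single i (x i) = (\<Sum>b\<in>B i. kact A (direct_sum I N) (c i b) (single i b))" .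
    qed
    also have "\<dots> = (\<Sum>p\<in>Sigma I B. kact A (direct_sum I N) (case p of (i, b) \<Rightarrow> c i b)
        (case p of (i, b) \<Rightarrow> single i b))"
      using I B(1) by (simp add: sum.Sigma split_def)
    finally show "\<exists>c. x = (\<Sum>p\<in>Sigma I B. kact A (direct_sum I N) (c p) (case p of (i, b) \<Rightarrow> single i b))"
      by blast
  qed
qed

text \<open>
  The submodule is the sum of the images of the \<open>S\<^sub>i\<close> under the inclusions of the summands, and
  superfluity is stable under images and under finite sums.
\<close>

lemma superfluous_direct_sum:
  assumes I: "finite I" and N: "\<And>i. i \<in> I \<Longrightarrow> left_module A (N i)"
    and S: "\<And>i. i \<in> I \<Longrightarrow> superfluous A (N i) (S i)"
  shows "superfluous A (direct_sum I N) {x. (\<forall>i\<in>I. x i \<in> S i) \<and> (\<forall>i. i \<notin> I \<longrightarrow> x i = 0)}"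
proof -
  note DS = left_module_direct_sum[of I A N, OF N]
  have zero: "0 \<in> S i" if "i \<in> I" for i
    using S[OF that] left_module.zero_closed by (fastforce simp: superfluous_def submodule_def)
  have "superfluous A (direct_sum I N) {x. (\<forall>i\<in>J. x i \<in> S i) \<and> (\<forall>i. i \<notin> J \<longrightarrow> x i = 0)}"
    if "J \<subseteq> I" for J
    using finite_subset[OF that I] that
  proof (induction J rule: finite_induct)
    case empty
    have "{x. (\<forall>i\<in>{}. x i \<in> S i) \<and> (\<forall>i. i \<notin> {} \<longrightarrow> x i = 0)} = {0}" by (auto simp: fun_eq_iff)
    then show ?case using superfluous_zero[OF DS] by simp
  next
    case (insert k J)
    have k: "k \<in> I" using insert by auto
    have eq: "{s + s' |s s'. s \<in> single k ` S k \<and> s' \<in> {x. (\<forall>i\<in>J. x i \<in> S i) \<and> (\<forall>i. i \<notin> J \<longrightarrow> x i = 0)}}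
      = {x. (\<forall>i\<in>insert k J. x i \<in> S i) \<and> (\<forall>i. i \<notin> insert k J \<longrightarrow> x i = 0)}" (is "?L = ?R")
    proof
      show "?L \<subseteq> ?R" using insert.hyps by (auto simp: single_def)
      show "?R \<subseteq> ?L"
      proof
        fix x assume x: "x \<in> ?R"
        have "x = single k (x k) + x(k := 0)" by (auto simp: single_def fun_eq_iff)
        moreover have "single k (x k) \<in> single k ` S k" using x by auto
        moreover have "x(k := 0) \<in> {x. (\<forall>i\<in>J. x i \<in> S i) \<and> (\<forall>i. i \<notin> J \<longrightarrow> x i = 0)}"
          using x insert.hyps by auto
        ultimately show "x \<in> ?L" by blast
      qed
    qed
    have "superfluous A (direct_sum I N) (single k ` S k)"
      by (rule superfluous_image[OF N[OF k] DS single_hom[of I A N, OF N k] S[OF k]]) auto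
    from superfluous_add[OF DS this insert.IH] show ?case
      using insert.prems unfolding eq by simp
  qed
  then show ?thesis by blast
qed

subsection \<open>Dual bases\<close>

definition regular_module :: "('k, 'r) kalg \<Rightarrow> ('r, 'r) lmod" where
  "regular_module A = \<lparr>mcar = UNIV, mact = amult A\<rparr>"

definition dual_basis ::
  "('k, 'r) kalg \<Rightarrow> ('r, 'm::ab_group_add) lmod \<Rightarrow> 'i set \<Rightarrow> ('i \<Rightarrow> 'm) \<Rightarrow> ('i \<Rightarrow> 'm \<Rightarrow> 'r::ab_group_add) \<Rightarrow> bool" where
  "dual_basis A P I g s \<longleftrightarrow> finite I \<and> g ` I \<subseteq> mcar P \<and>
     (\<forall>i\<in>I. lmod_hom P (regular_module A) (s i)) \<and>
     (\<forall>x\<in>mcar P. x = (\<Sum>i\<in>I. mact P (s i x) (g i)))"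

text \<open>
  A module with a finite dual basis has the lifting property: choose a preimage for the image of
  each generator and extend by the coordinate functionals. The carriers of the test modules are
  arbitrary here, so that maps between the modules \<open>Q\<^sub>i\<close> can be lifted as well.
\<close>

lemma dual_basis_lift:
  assumes P: "left_module A P" and X: "left_module A X" and Y: "left_module A Y"
    and db: "dual_basis A P I g s"
    and \<phi>: "lmod_hom X Y \<phi>" and h: "lmod_hom P Y h"
    and im: "\<And>i. i \<in> I \<Longrightarrow> h (g i) \<in> \<phi> ` mcar X"
  shows "\<exists>l. lmod_hom P X l \<and> (\<forall>x\<in>mcar P. \<phi> (l x) = h x)"
proof -
  interpret P: left_module A P by fact
  interpret X: left_module A X by fact
  have g: "g i \<in> mcar P" and s: "lmod_hom P (regular_module A) (s i)" if "i \<in> I" for i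
    using db that by (auto simp: dual_basis_def)
  have expand: "x = (\<Sum>i\<in>I. mact P (s i x) (g i))" if "x \<in> mcar P" for x
    using db that by (simp add: dual_basis_def)
  obtain y where y: "\<And>i. i \<in> I \<Longrightarrow> y i \<in> mcar X" "\<And>i. i \<in> I \<Longrightarrow> \<phi> (y i) = h (g i)"
    using bchoice[of I "\<lambda>i y. y \<in> mcar X \<and> \<phi> y = h (g i)"] im by (auto simp: image_iff Bex_def eq_commute)
  let ?l = "\<lambda>x. \<Sum>i\<in>I. mact X (s i x) (y i)"
  have "lmod_hom P X ?l"
  proof (rule lmod_homI)
    show "?l x \<in> mcar X" for x using y by (intro X.sum_closed X.act_closed)
    show "?l (x + x') = ?l x + ?l x'" if "x \<in> mcar P" "x' \<in> mcar P" for x x'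
      unfolding sum.distrib[symmetric]
      using that y lmod_homD(2)[OF s] by (intro sum.cong) (auto simp: X.act_add_left)
    show "?l (mact P a x) = mact X a (?l x)" if "x \<in> mcar P" for a x
    proof -
      have "mact X (s i (mact P a x)) (y i) = mact X a (mact X (s i x) (y i))" if "i \<in> I" for i
        using lmod_homD(3)[OF s[OF that] \<open>x \<in> mcar P\<close>, of a] y(1)[OF that]
        by (simp add: regular_module_def X.act_mult)
      then show ?thesis using y by (simp add: X.act_sum_right X.act_closed)
    qed
  qed
  moreover have "\<phi> (?l x) = h x" if "x \<in> mcar P" for x
  proof -
    have "\<phi> (?l x) = (\<Sum>i\<in>I. \<phi> (mact X (s i x) (y i)))"
      by (rule X.additive_sum) (auto simp: lmod_homD(2)[OF \<phi>] y X.act_closed)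
    also have "\<dots> = (\<Sum>i\<in>I. h (mact P (s i x) (g i)))"
      by (intro sum.cong) (auto simp: lmod_homD(3)[OF \<phi>] lmod_homD(3)[OF h] y g)
    also have "\<dots> = h (\<Sum>i\<in>I. mact P (s i x) (g i))"
      by (rule P.additive_sum[symmetric]) (auto simp: lmod_homD(2)[OF h] g P.act_closed)
    finally show ?thesis using expand[OF that] by simp
  qed
  ultimately show ?thesis by blast
qed

lemma projective_dual_basis:
  fixes A :: "('k::field, 'r::ab_group_add) kalg" and P :: "('r, 'm::ab_group_add) lmod"
  assumes fd: "fd_module A P" and db: "dual_basis A P I g s"
  shows "projective A P"
  unfolding projective_def
proof (intro conjI allI impI fd)
  fix X Y :: "('r, nat \<Rightarrow> 'k) lmod" and \<phi> h
  assume X: "fd_module A X" and Y: "fd_module A Y" and \<phi>: "lmod_hom X Y \<phi>" "\<phi> ` mcar X = mcar Y"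
    and h: "lmod_hom P Y h"
  have "h (g i) \<in> \<phi> ` mcar X" if "i \<in> I" for i
    using db that lmod_homD(1)[OF h] \<phi>(2) by (auto simp: dual_basis_def)
  with fd X Y show "\<exists>l. lmod_hom P X l \<and> (\<forall>x\<in>mcar P. \<phi> (l x) = h x)"
    by (intro dual_basis_lift[OF _ _ _ db \<phi>(1) h]) (auto simp: fd_module_def)
qed

section \<open>The deformed algebra and its modules\<close>

lemma algA_simps [simp]:
  "ascale (algA sc) = sc" "amult (algA sc) a b = a * b" "aone (algA sc) = 1"
  by (simp_all add: algA_def)

lemma algAf_simps [simp]:
  "ascale (algAf sc f) c (a, a') = (sc c a, sc c a')"
  "amult (algAf sc f) (a, a') (b, b') = (a * b, a * b' + a' * b + f a b)"
  "aone (algAf sc f) = (1, - f 1 1)"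
  by (simp_all add: algAf_def)

lemma tuple_module_simps [simp]:
  "mcar (tuple_module X) = mcar (tup0 X) \<times> mcar (tup1 X)"
  "mact (tuple_module X) (a, b) (m0, m1) =
     (mact (tup0 X) a m0, mact (tup1 X) a m1 + mact (tup1 X) b (tupT X m0) + tupf X a m0)"
  by (simp_all add: tuple_module_def)

locale deformation =
  fixes sc :: "'k::field \<Rightarrow> 'a \<Rightarrow> 'a::{ring,monoid_mult}" and f :: "'a \<Rightarrow> 'a \<Rightarrow> 'a"
  assumes fd_algebra: "fd_algebra (algA sc)" and cocycle: "hochschild_2_cocycle sc f"
begin

lemma vector_space_A: "vector_space sc"
  using fd_algebra.vector_space[OF fd_algebra] by simp

lemma scale_simps:
  "sc c (a + b) = sc c a + sc c b" "sc (c + d) a = sc c a + sc d a"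
  "sc c (sc d a) = sc (c * d) a" "sc 1 a = a"
  using vector_space_A by (simp_all add: vector_space_def)

lemma scale_mult: "sc c (a * b) = sc c a * b" "a * sc c b = sc c a * b"
  using fd_algebra.mult_linear_left[OF fd_algebra] fd_algebra.mult_linear_right[OF fd_algebra]
  by (simp_all add: Vector_Spaces.linear_iff)

lemma scale_one_mult: "sc c 1 * a = sc c a" "a * sc c 1 = sc c a"
  using scale_mult(1)[of c 1 a] scale_mult(2)[of a c 1] by simp_all

lemma vector_space_Af: "vector_space (ascale (algAf sc f))"
  by standard (auto simp: algAf_def scale_simps)

lemma f_add: "f (a + b) c = f a c + f b c" "f a (b + c) = f a b + f a c"
  and f_scale: "f (sc k a) c = sc k (f a c)" "f a (sc k c) = sc k (f a c)"
  using cocycle by (simp_all add: hochschild_2_cocycle_def Vector_Spaces.linear_iff)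

lemma f_zero [simp]: "f 0 c = 0" "f a 0 = 0"
  using f_add(1)[of 0 0 c] f_add(2)[of a 0 0] by simp_all

lemma f_sum_right: "f a (\<Sum>i\<in>I. g i) = (\<Sum>i\<in>I. f a (g i))"
  by (induction I rule: infinite_finite_induct) (auto simp: f_add)

lemma f_cocycle: "f a b * c = a * f b c - f (a * b) c + f a (b * c)"
  using cocycle by (simp add: hochschild_2_cocycle_def algebra_simps)

end

locale deformation_tuple = deformation sc f
  for sc :: "'k::field \<Rightarrow> 'a \<Rightarrow> 'a::{ring,monoid_mult}" and f :: "'a \<Rightarrow> 'a \<Rightarrow> 'a" +
  fixes X :: "('a, 'm::ab_group_add, 'n::ab_group_add) tup"
  assumes is_tuple: "is_tuple sc f X"
begin

sublocale M0: left_module "algA sc" "tup0 X"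
  using is_tuple by (simp add: is_tuple_def fd_module_def)

sublocale M1: left_module "algA sc" "tup1 X"
  using is_tuple by (simp add: is_tuple_def fd_module_def)

lemma T_hom: "lmod_hom (tup0 X) (tup1 X) (tupT X)"
  and f_linear: "k_linear (algA sc) (tup0 X) (tup1 X) (tupf X a)"
  and f_add_left: "m \<in> mcar (tup0 X) \<Longrightarrow> tupf X (a + b) m = tupf X a m + tupf X b m"
  and f_scale_left: "m \<in> mcar (tup0 X) \<Longrightarrow>
    tupf X (sc c a) m = kact (algA sc) (tup1 X) c (tupf X a m)"
  and f_tuple: "m \<in> mcar (tup0 X) \<Longrightarrow>
    tupf X (a * b) m = mact (tup1 X) a (tupf X b m) + tupf X a (mact (tup0 X) b m)
      - mact (tup1 X) (f a b) (tupT X m)"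
  using is_tuple by (simp_all add: is_tuple_def algebra_simps)

lemmas T_closed = lmod_homD(1)[OF T_hom] and T_add = lmod_homD(2)[OF T_hom]
  and T_act = lmod_homD(3)[OF T_hom]
lemmas f_closed = k_linearD(1)[OF f_linear] and f_add_right = k_linearD(2)[OF f_linear]

lemma f_one: "m \<in> mcar (tup0 X) \<Longrightarrow> tupf X 1 m = mact (tup1 X) (f 1 1) (tupT X m)"
  using f_tuple[of m 1 1] M1.act_one[of "tupf X 1 m"] M0.act_one[of m] by (simp add: f_closed)

lemma M0_mult: "m \<in> mcar (tup0 X) \<Longrightarrow> mact (tup0 X) (a * b) m = mact (tup0 X) a (mact (tup0 X) b m)"
  using M0.act_mult[of m a b] by simp

lemma M1_mult: "m \<in> mcar (tup1 X) \<Longrightarrow> mact (tup1 X) (a * b) m = mact (tup1 X) a (mact (tup1 X) b m)"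
  using M1.act_mult[of m a b] by simp

lemma left_module_tuple: "left_module (algAf sc f) (tuple_module X)"
proof
  fix x and a b :: "'a \<times> 'a" assume x: "x \<in> mcar (tuple_module X)"
  obtain m0 m1 a0 a1 b0 b1 where eq: "x = (m0, m1)" "a = (a0, a1)" "b = (b0, b1)"
    by (cases x, cases a, cases b)
  have m: "m0 \<in> mcar (tup0 X)" "m1 \<in> mcar (tup1 X)" using x eq by auto
  show "mact (tuple_module X) (amult (algAf sc f) a b) x
      = mact (tuple_module X) a (mact (tuple_module X) b x)"
    unfolding eq using m
    by (simp add: M0_mult M1_mult M1.act_add_left M1.act_add_right T_closed T_act f_closed f_tuple
        M0.act_closed M1.act_closed M1.add_closed algebra_simps)
  show "mact (tuple_module X) (aone (algAf sc f)) x = x"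
    unfolding eq using m M0.act_one[of m0] M1.act_one[of m1]
    by (simp add: f_one M1.act_minus_left T_closed)
qed (auto simp: M0.zero_closed M1.zero_closed M0.add_closed M1.add_closed M0.minus_closed
    M1.minus_closed M0.act_closed M1.act_closed T_closed f_closed M0.act_add_right M1.act_add_right
    M0.act_add_left M1.act_add_left T_add f_add_right f_add_left zero_prod_def algebra_simps)

text \<open>
  The term \<open>- f(1 \<otimes> 1)t\<close> of the unit cancels \<open>f\<^sub>M(1 \<otimes> m)\<close>, so that scalars act componentwise.
\<close>

lemma kact_tuple:
  assumes "m0 \<in> mcar (tup0 X)" "m1 \<in> mcar (tup1 X)"
  shows "kact (algAf sc f) (tuple_module X) c (m0, m1) =
    (kact (algA sc) (tup0 X) c m0, kact (algA sc) (tup1 X) c m1)"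
proof -
  have "mact (tup1 X) (sc c (- f 1 1)) (tupT X m0) + tupf X (sc c 1) m0 = 0"
  proof -
    have "tupf X (sc c 1) m0 = mact (tup1 X) (sc c (f 1 1)) (tupT X m0)"
      using assms by (simp add: f_scale_left f_one kact_def M1_mult[symmetric] T_closed scale_one_mult)
    moreover have "sc c (- f 1 1) + sc c (f 1 1) = 0"
      using scale_simps(1)[of c "- f 1 1" "f 1 1"] scale_simps(1)[of c 0 0] by simp
    ultimately show ?thesis
      using assms by (simp add: M1.act_add_left[symmetric] T_closed)
  qed
  then show ?thesis by (simp add: kact_def add.assoc)
qed

lemma fd_module_tuple: "fd_module (algAf sc f) (tuple_module X)"
proof -
  have is_tuple_fd: "fd_module (algA sc) (tup0 X) \<and> fd_module (algA sc) (tup1 X)"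
    using is_tuple by (simp add: is_tuple_def)
  obtain B0 where B0: "finite B0" "B0 \<subseteq> mcar (tup0 X)"
    "\<And>x. x \<in> mcar (tup0 X) \<Longrightarrow> \<exists>c. x = (\<Sum>b\<in>B0. kact (algA sc) (tup0 X) (c b) b)"
    using conjunct1[OF is_tuple_fd] unfolding fd_module_def by blast
  obtain B1 where B1: "finite B1" "B1 \<subseteq> mcar (tup1 X)"
    "\<And>x. x \<in> mcar (tup1 X) \<Longrightarrow> \<exists>c. x = (\<Sum>b\<in>B1. kact (algA sc) (tup1 X) (c b) b)"
    using conjunct2[OF is_tuple_fd] unfolding fd_module_def by blast
  have zero: "kact (algA sc) (tup0 X) c 0 = 0" "kact (algA sc) (tup1 X) c 0 = 0" for c
    by (simp_all add: kact_def)
  show ?thesis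
  proof (rule fd_moduleI[OF left_module_tuple vector_space_Af, where I = "B0 <+> B1"
        and g = "case_sum (\<lambda>b. (b, 0)) (\<lambda>b. (0, b))"])
    show "finite (B0 <+> B1)" using B0 B1 by simp
    show "case_sum (\<lambda>b. (b, 0)) (\<lambda>b. (0, b)) i \<in> mcar (tuple_module X)" if "i \<in> B0 <+> B1" for i
      using that B0(2) B1(2) by (auto simp: M0.zero_closed M1.zero_closed)
  next
    fix x assume "x \<in> mcar (tuple_module X)"
    then obtain m0 m1 where x: "x = (m0, m1)" "m0 \<in> mcar (tup0 X)" "m1 \<in> mcar (tup1 X)"
      by (cases x) auto
    obtain c where c: "m0 = (\<Sum>b\<in>B0. kact (algA sc) (tup0 X) (c b) b)" using B0(3) x(2) by blast
    obtain d where d: "m1 = (\<Sum>b\<in>B1. kact (algA sc) (tup1 X) (d b) b)" using B1(3) x(3) by blast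
    have "(\<Sum>i\<in>B0 <+> B1. kact (algAf sc f) (tuple_module X) (case_sum c d i)
        (case_sum (\<lambda>b. (b, 0)) (\<lambda>b. (0, b)) i))
      = (\<Sum>b\<in>B0. kact (algAf sc f) (tuple_module X) (c b) (b, 0))
        + (\<Sum>b\<in>B1. kact (algAf sc f) (tuple_module X) (d b) (0, b))"
      using B0(1) B1(1) by (simp add: sum.Plus)
    also have "\<dots> = (\<Sum>b\<in>B0. (kact (algA sc) (tup0 X) (c b) b, 0))
        + (\<Sum>b\<in>B1. (0, kact (algA sc) (tup1 X) (d b) b))"
      using B0(2) B1(2)
      by (intro arg_cong2[where f = "(+)"] sum.cong)
         (auto simp: kact_tuple subset_iff M0.zero_closed M1.zero_closed zero)
    also have "\<dots> = x" by (simp add: x(1) sum_prod c[symmetric] d[symmetric])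
    finally show "\<exists>c. x = (\<Sum>i\<in>B0 <+> B1. kact (algAf sc f) (tuple_module X) (c i)
        (case_sum (\<lambda>b. (b, 0)) (\<lambda>b. (0, b)) i))"
      by (intro exI[of _ "case_sum c d"]) simp
  qed
qed

text \<open>
  Nakayama's lemma for the nilpotent ideal \<open>At\<close>: if \<open>T\<close> is onto then the second components are
  multiples of \<open>t\<close>, so that superfluity of a submodule can be tested on its first components.
\<close>

lemma superfluous_tuple:
  assumes surj: "tupT X ` mcar (tup0 X) = mcar (tup1 X)"
    and N: "superfluous (algA sc) (tup0 X) N"
    and S: "submodule (algAf sc f) (tuple_module X) S" "fst ` S \<subseteq> N"
  shows "superfluous (algAf sc f) (tuple_module X) S"
proof (rule superfluousI[OF S(1)])
  fix Y assume Y: "submodule (algAf sc f) (tuple_module X) Y"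
    and dec: "\<And>z. z \<in> mcar (tuple_module X) \<Longrightarrow> \<exists>s\<in>S. \<exists>y\<in>Y. z = s + y"
  interpret Y: left_module "algAf sc f" "tuple_module X\<lparr>mcar := Y\<rparr>"
    using Y by (simp add: submodule_def)
  have sub: "Y \<subseteq> mcar (tup0 X) \<times> mcar (tup1 X)" using Y by (simp add: submodule_def)
  have fst_Y: "fst ` Y = mcar (tup0 X)"
  proof (rule superfluousD[OF M0.left_module_axioms N])
    show "submodule (algA sc) (tup0 X) (fst ` Y)"
    proof (rule submoduleI[OF M0.left_module_axioms])
      show "fst ` Y \<subseteq> mcar (tup0 X)" using sub by auto
      show "0 \<in> fst ` Y" using Y.zero_closed by (intro image_eqI[of _ _ 0]) auto
    next
      fix x y assume "x \<in> fst ` Y" "y \<in> fst ` Y"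
      then obtain p q where "p \<in> Y" "x = fst p" "q \<in> Y" "y = fst q" by auto
      then show "x + y \<in> fst ` Y" using Y.add_closed[of p q] by (intro image_eqI[of _ _ "p + q"]) auto
    next
      fix a x assume "x \<in> fst ` Y"
      then obtain x1 where "(x, x1) \<in> Y" by auto
      then show "mact (tup0 X) a x \<in> fst ` Y"
        using Y.act_closed[of "(x, x1)" "(a, 0)"] by (force intro: image_eqI[rotated])
    qed
  next
    fix z assume "z \<in> mcar (tup0 X)"
    then have "(z, 0) \<in> mcar (tuple_module X)" by (simp add: M1.zero_closed)
    from dec[OF this] obtain s y where sy: "s \<in> S" "y \<in> Y" "(z, 0) = s + y" by blast
    have "z = fst s + fst y" using arg_cong[OF sy(3), of fst] by simp
    then show "\<exists>s\<in>N. \<exists>y\<in>fst ` Y. z = s + y"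
      using S(2) sy by (intro bexI[of _ "fst s"] bexI[of _ "fst y"]) auto
  qed
  have second: "(0, m1) \<in> Y" if m1: "m1 \<in> mcar (tup1 X)" for m1
  proof -
    obtain m0 where m0: "m0 \<in> mcar (tup0 X)" "m1 = tupT X m0" using surj m1 by blast
    then obtain y where y: "(m0, y) \<in> Y" using fst_Y by force
    have f0: "tupf X 0 m0 = 0" using f_add_left[OF m0(1), of 0 0] by simp
    have "mact (tuple_module X) (0, 1) (m0, y) = (0, m1)"
      using y sub m0 M1.act_one[of m1] m1 by (auto simp: f0)
    then show ?thesis using Y.act_closed[of "(m0, y)" "(0, 1)"] y by simp
  qed
  show "mcar (tuple_module X) \<subseteq> Y"
  proof
    fix z assume "z \<in> mcar (tuple_module X)"
    then obtain z0 z1 where z: "z = (z0, z1)" "z0 \<in> mcar (tup0 X)" "z1 \<in> mcar (tup1 X)"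
      by (cases z) auto
    obtain y where y: "(z0, y) \<in> Y" using fst_Y z(2) by force
    then have "(0, z1 - y) \<in> Y" using second[of "z1 - y"] z sub by (auto intro: M1.diff_closed)
    then show "z \<in> Y" using Y.add_closed[of "(z0, y)" "(0, z1 - y)"] y z(1) by simp
  qed
qed

end

context deformation
begin

lemma lmod_hom_triple_map:
  assumes X: "is_tuple sc f X" and Y: "is_tuple sc f Y" and u: "is_triple sc X Y u"
  shows "lmod_hom (tuple_module X) (tuple_module Y) (triple_map u)"
proof -
  interpret X: deformation_tuple sc f X by standard fact
  interpret Y: deformation_tuple sc f Y by standard fact
  obtain u0 u1 u2 where u_eq: "u = (u0, u1, u2)" by (cases u)
  have u0: "lmod_hom (tup0 X) (tup0 Y) u0" and u2: "lmod_hom (tup1 X) (tup1 Y) u2"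
    and u1: "k_linear (algA sc) (tup0 X) (tup1 Y) u1"
    and uT: "\<And>m. m \<in> mcar (tup0 X) \<Longrightarrow> tupT Y (u0 m) = u2 (tupT X m)"
    and uf: "\<And>a m. m \<in> mcar (tup0 X) \<Longrightarrow>
      u1 (mact (tup0 X) a m) = mact (tup1 Y) a (u1 m) - u2 (tupf X a m) + tupf Y a (u0 m)"
    using u unfolding u_eq is_triple_def by auto
  note [simp] = lmod_homD[OF u0] lmod_homD[OF u2] k_linearD[OF u1] X.T_closed X.f_closed
    X.M1.act_closed X.M1.add_closed Y.M1.act_add_right Y.M1.act_add_left Y.M1.act_closed
  show ?thesis
    unfolding u_eq triple_map_def
  proof (rule lmod_homI)
    fix a x assume "x \<in> mcar (tuple_module X)"
    then show "(\<lambda>(u0, u1, u2) (m0, m1). (u0 m0, u1 m0 + u2 m1)) (u0, u1, u2) (mact (tuple_module X) a x)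
      = mact (tuple_module Y) a ((\<lambda>(u0, u1, u2) (m0, m1). (u0 m0, u1 m0 + u2 m1)) (u0, u1, u2) x)"
      by (cases a; cases x) (simp add: uT uf algebra_simps)
  qed (auto simp: Y.M1.add_closed algebra_simps)
qed

lemma is_tuple_inflate:
  assumes "fd_module (algA sc) M"
  shows "is_tuple sc f (inflate M)"
proof -
  interpret M: left_module "algA sc" M using assms by (simp add: fd_module_def)
  have Z: "left_module (algA sc) zero_module" by standard (auto simp: zero_module_def)
  have "fd_module (algA sc) zero_module"
    unfolding fd_module_def using Z by (auto simp: zero_module_def intro!: exI[of _ "{}"])
  then show ?thesis
    using assms
    by (auto simp: is_tuple_def inflate_def zero_module_def lmod_hom_def k_linear_def kact_def
        M.zero_closed)
qed

lemma is_tuple_tuple_sum: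
  assumes I: "finite I" and X: "\<And>i. i \<in> I \<Longrightarrow> is_tuple sc f (X i)"
  shows "is_tuple sc f (tuple_sum I X)"
proof -
  have loc: "deformation_tuple sc f (X i)" if "i \<in> I" for i
    by (intro deformation_tuple.intro deformation_axioms deformation_tuple_axioms.intro X that)
  note facts = deformation_tuple.T_closed[OF loc] deformation_tuple.T_add[OF loc]
    deformation_tuple.T_act[OF loc] deformation_tuple.f_closed[OF loc]
    deformation_tuple.f_add_right[OF loc] deformation_tuple.f_add_left[OF loc]
    k_linearD(3)[OF deformation_tuple.f_linear[OF loc], unfolded kact_def algA_simps]
    deformation_tuple.f_scale_left[OF loc, unfolded kact_def algA_simps]
    deformation_tuple.f_tuple[OF loc]
  have fd: "fd_module (algA sc) (tup0 (X i))" "fd_module (algA sc) (tup1 (X i))"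
    and inj: "inj_on (tupT (X i)) (mcar (tup0 (X i)))" if "i \<in> I" for i
    using X[OF that] by (simp_all add: is_tuple_def)
  have vs: "vector_space (ascale (algA sc))" by (simp add: vector_space_A)
  show ?thesis
    unfolding is_tuple_def tuple_sum_def tup.simps
  proof (intro conjI allI ballI)
    show "fd_module (algA sc) (direct_sum I (\<lambda>i. tup0 (X i)))"
      by (rule fd_module_direct_sum[OF vs I fd(1)])
    show "fd_module (algA sc) (direct_sum I (\<lambda>i. tup1 (X i)))"
      by (rule fd_module_direct_sum[OF vs I fd(2)])
    show "inj_on (\<lambda>x i. if i \<in> I then tupT (X i) (x i) else 0) (mcar (direct_sum I (\<lambda>i. tup0 (X i))))"
    proof (rule inj_onI)
      fix x y assume x: "x \<in> mcar (direct_sum I (\<lambda>i. tup0 (X i)))"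
        and y: "y \<in> mcar (direct_sum I (\<lambda>i. tup0 (X i)))"
        and eq: "(\<lambda>i. if i \<in> I then tupT (X i) (x i) else 0) = (\<lambda>i. if i \<in> I then tupT (X i) (y i) else 0)"
      show "x = y"
      proof
        fix i show "x i = y i"
          using x y fun_cong[OF eq, of i] inj_onD[OF inj, of i "x i" "y i"] by (cases "i \<in> I") auto
      qed
    qed
  qed (auto simp: fun_eq_iff facts kact_def intro!: lmod_homI k_linearI)
qed

end

section \<open>Decomposed projective modules\<close>

lemma Ae_simps [simp]: "mcar (Ae u) = {a * u |a. True}" "mact (Ae u) = (*)"
  by (simp_all add: Ae_def)

lemma mact_projQ:
  "mact (projQ e js) a x = (\<lambda>r. if r < length js then a * x r else 0)"
  by (simp add: projQ_def fun_eq_iff)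

lemma left_module_projQ: "left_module (algA sc) (projQ e js)"
  for sc :: "'k::field \<Rightarrow> 'a::{ring,monoid_mult} \<Rightarrow> 'a"
  unfolding projQ_def
proof (rule left_module_direct_sum)
  have "left_module (algA sc) (Ae u)" for u
  proof
    show "0 \<in> mcar (Ae u)" by (auto intro: exI[of _ 0])
    show "x + y \<in> mcar (Ae u)" if "x \<in> mcar (Ae u)" "y \<in> mcar (Ae u)" for x y
      using that by (auto simp: distrib_right[symmetric])
    show "- x \<in> mcar (Ae u)" if "x \<in> mcar (Ae u)" for x
      using that by (auto intro: exI[of _ "- a" for a] simp flip: mult_minus_left)
    show "mact (Ae u) a x \<in> mcar (Ae u)" if "x \<in> mcar (Ae u)" for a x
      using that by (auto simp: mult.assoc[symmetric])
  qed (auto simp: algebra_simps)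
  then show "left_module (algA sc) (Ae (e (js ! r)))" for r .
qed

definition idempotents_at :: "(nat \<Rightarrow> 'a::{ring,monoid_mult}) \<Rightarrow> nat list \<Rightarrow> bool" where
  "idempotents_at e js \<longleftrightarrow> (\<forall>r<length js. e (js ! r) * e (js ! r) = e (js ! r))"

lemma projQ_iff:
  assumes "idempotents_at e js"
  shows "x \<in> mcar (projQ e js) \<longleftrightarrow>
    (\<forall>r<length js. x r * e (js ! r) = x r) \<and> (\<forall>r\<ge>length js. x r = 0)"
proof -
  have "(\<exists>a. x r = a * e (js ! r)) \<longleftrightarrow> x r * e (js ! r) = x r" if "r < length js" for r
    using assms that unfolding idempotents_at_def by (metis mult.assoc)
  then show ?thesis by (auto simp: projQ_def not_less)
qed

definition generator :: "(nat \<Rightarrow> 'a::{ring,monoid_mult}) \<Rightarrow> nat list \<Rightarrow> nat \<Rightarrow> nat \<Rightarrow> 'a" where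
  "generator e js r = single r (e (js ! r))"

lemma generator_closed:
  "idempotents_at e js \<Longrightarrow> r < length js \<Longrightarrow> generator e js r \<in> mcar (projQ e js)"
  by (auto simp: projQ_iff generator_def single_def idempotents_at_def)

lemma mact_generator:
  "r < length js \<Longrightarrow> mact (projQ e js) a (generator e js r) = single r (a * e (js ! r))"
  by (auto simp: mact_projQ generator_def single_def fun_eq_iff)

lemma dual_basis_projQ:
  fixes sc :: "'k::field \<Rightarrow> 'a::{ring,monoid_mult} \<Rightarrow> 'a"
  assumes "idempotents_at e js"
  shows "dual_basis (algA sc) (projQ e js) {..<length js} (generator e js) (\<lambda>r x. x r)"
  unfolding dual_basis_def
proof (intro conjI ballI)
  show "lmod_hom (projQ e js) (regular_module (algA sc)) (\<lambda>x. x r)" if "r \<in> {..<length js}" for r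
    using that by (intro lmod_homI) (auto simp: regular_module_def mact_projQ)
  show "x = (\<Sum>r\<in>{..<length js}. mact (projQ e js) (x r) (generator e js r))"
    if "x \<in> mcar (projQ e js)" for x
  proof -
    have "x = (\<Sum>r<length js. single r (x r))"
      using that by (intro sum_single) (auto simp: projQ_iff[OF assms])
    also have "\<dots> = (\<Sum>r<length js. mact (projQ e js) (x r) (generator e js r))"
      using that by (intro sum.cong) (auto simp: mact_generator projQ_iff[OF assms])
    finally show ?thesis .
  qed
qed (auto simp: generator_closed[OF assms])

subsection \<open>Matrices\<close>

lemma sum_Emat: "s < l \<Longrightarrow> (\<Sum>k<l. g k * Emat e js k s) = g s * e (js ! s)"
proof -
  assume "s < l"
  have "(\<Sum>k<l. g k * Emat e js k s) = (\<Sum>k<l. if k = s then g s * e (js ! s) else 0)"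
    by (intro sum.cong) (auto simp: Emat_def)
  then show ?thesis using \<open>s < l\<close> by simp
qed

lemma sum_Emat_left: "r < l \<Longrightarrow> (\<Sum>k<l. Emat e js r k * g k) = e (js ! r) * g r"
proof -
  assume "r < l"
  have "(\<Sum>k<l. Emat e js r k * g k) = (\<Sum>k<l. if k = r then e (js ! r) * g r else 0)"
    by (intro sum.cong) (auto simp: Emat_def)
  then show ?thesis using \<open>r < l\<close> by simp
qed

lemma is_matrix_of_iff:
  "is_matrix_of e js js' B d \<longleftrightarrow>
     (\<forall>r<length js. \<forall>s<length js'. e (js ! r) * B r s * e (js' ! s) = B r s) \<and>
     (\<forall>x\<in>mcar (projQ e js). \<forall>s<length js'. d x s = (\<Sum>k<length js. x k * B k s))"
  by (simp add: is_matrix_of_def matmul_def row_def sum_Emat sum_Emat_left)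

lemma is_matrix_ofD:
  assumes "is_matrix_of e js js' B d" "idempotents_at e js" "idempotents_at e js'"
  shows "r < length js \<Longrightarrow> s < length js' \<Longrightarrow> e (js ! r) * B r s = B r s"
    and "r < length js \<Longrightarrow> s < length js' \<Longrightarrow> B r s * e (js' ! s) = B r s"
    and "x \<in> mcar (projQ e js) \<Longrightarrow> s < length js' \<Longrightarrow> d x s = (\<Sum>k<length js. x k * B k s)"
proof -
  have sandwich: "e (js ! r) * B r s * e (js' ! s) = B r s"
    if "r < length js" "s < length js'" using assms(1) that by (simp add: is_matrix_of_iff)
  have ee: "e (js ! r) * e (js ! r) = e (js ! r)" if "r < length js"
    using assms(2) that by (simp add: idempotents_at_def)
  have ee': "e (js' ! s) * e (js' ! s) = e (js' ! s)" if "s < length js'"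
    using assms(3) that by (simp add: idempotents_at_def)
  show "e (js ! r) * B r s = B r s" if "r < length js" "s < length js'"
    by (subst (1 2) sandwich[OF that, symmetric]) (simp add: ee[OF that(1)] flip: mult.assoc)
  show "B r s * e (js' ! s) = B r s" if "r < length js" "s < length js'"
    by (subst (1 2) sandwich[OF that, symmetric]) (simp add: ee'[OF that(2)] mult.assoc)
  show "d x s = (\<Sum>k<length js. x k * B k s)" if "x \<in> mcar (projQ e js)" "s < length js'"
    using assms(1) that by (simp add: is_matrix_of_iff)
qed

lemma Tdelta_apply:
  "Tdelta e f js js' B x s =
    (if s < length js' then (\<Sum>k<length js. f (x k) (B k s)) * e (js' ! s) else 0)"
  by (simp add: Tdelta_def matmul_def ftilde_def row_def sum_Emat)

context deformation
begin

lemma lmod_hom_has_matrix: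
  fixes e :: "nat \<Rightarrow> 'a"
  assumes js: "idempotents_at e js" and js': "idempotents_at e js'"
    and d: "lmod_hom (projQ e js) (projQ e js') d"
  shows "\<exists>B. is_matrix_of e js js' B d"
proof
  let ?B = "\<lambda>r. d (generator e js r)"
  interpret Q: left_module "algA sc" "projQ e js" by (rule left_module_projQ)
  have gen: "generator e js r \<in> mcar (projQ e js)" if "r < length js" for r
    using generator_closed[OF js that] .
  have act: "d (mact (projQ e js) a (generator e js r)) s = a * ?B r s"
    if "r < length js" "s < length js'" for a r s
    using lmod_homD(3)[OF d gen[OF that(1)], of a] that by (simp add: mact_projQ)
  show "is_matrix_of e js js' ?B d"
    unfolding is_matrix_of_iff
  proof (intro conjI allI impI ballI)
    fix r s assume rs: "r < length js" "s < length js'"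
    have "mact (projQ e js) (e (js ! r)) (generator e js r) = generator e js r"
      using js rs by (simp add: mact_generator idempotents_at_def) (simp add: generator_def)
    then have "e (js ! r) * ?B r s = ?B r s" using act[OF rs, of "e (js ! r)"] by simp
    moreover have "?B r s * e (js' ! s) = ?B r s"
      using lmod_homD(1)[OF d gen[OF rs(1)]] rs by (simp add: projQ_iff[OF js'])
    ultimately show "e (js ! r) * ?B r s * e (js' ! s) = ?B r s" by simp
  next
    fix x s assume x: "x \<in> mcar (projQ e js)" and s: "s < length js'"
    have "x = (\<Sum>k<length js. mact (projQ e js) (x k) (generator e js k))"
      using dual_basis_projQ[OF js, of sc] x by (simp add: dual_basis_def)
    then have "d x = d (\<Sum>k<length js. mact (projQ e js) (x k) (generator e js k))" by simp
    also have "\<dots> = (\<Sum>k<length js. d (mact (projQ e js) (x k) (generator e js k)))"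
      by (rule Q.additive_sum[of d, OF lmod_homD(2)[OF d]]) (auto simp: gen Q.act_closed)
    finally show "d x s = (\<Sum>k<length js. x k * ?B k s)"
      using s by (simp add: sum_fun_apply act)
  qed
qed

lemma kact_projQ:
  "kact (algA sc) (projQ e js) c x = (\<lambda>r. if r < length js then sc c (x r) else 0)"
  by (auto simp: kact_def mact_projQ scale_one_mult)

lemma fQ_closed: "idempotents_at e js \<Longrightarrow> fQ e f js a x \<in> mcar (projQ e js)"
  by (auto simp: projQ_iff fQ_def mult.assoc idempotents_at_def)

lemma fQ_zero [simp]: "fQ e f js a 0 = 0"
  by (simp add: fQ_def fun_eq_iff)

lemma is_tuple_hatQ:
  assumes js: "idempotents_at e js" and fd: "fd_module (algA sc) (projQ e js)"
  shows "is_tuple sc f (hatQ e f js)"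
  unfolding is_tuple_def hatQ_def tup.simps
proof (intro conjI allI ballI fd)
  fix a b m assume "m \<in> mcar (projQ e js)"
  then show "mact (projQ e js) a (fQ e f js b m) - fQ e f js (a * b) m
      + fQ e f js a (mact (projQ e js) b m) - mact (projQ e js) (f a b) m = 0"
    unfolding projQ_iff[OF js]
    by (auto simp: fun_eq_iff mact_projQ fQ_def)
       (metis f_cocycle[of a b] mult.assoc diff_self left_diff_distrib distrib_right)
next
  show "k_linear (algA sc) (projQ e js) (projQ e js) (fQ e f js a)" for a
    by (rule k_linearI)
       (rule fQ_closed[OF js],
        auto simp: fun_eq_iff fQ_def f_add distrib_right kact_projQ f_scale scale_mult(1))
qed (auto simp: fun_eq_iff fQ_def f_add distrib_right kact_projQ f_scale scale_mult(1) lmod_hom_def)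

lemma Tdelta_closed: "idempotents_at e js' \<Longrightarrow> Tdelta e f js js' B x \<in> mcar (projQ e js')"
  by (auto simp: projQ_iff Tdelta_apply mult.assoc idempotents_at_def)

lemma scale_sum: "(\<Sum>i\<in>I. sc c (g i)) = sc c (\<Sum>i\<in>I. g i)"
  using scale_simps(1)[of c 0 0]
  by (induction I rule: infinite_finite_induct) (auto simp: scale_simps(1))

lemma Tdelta_linear:
  assumes "idempotents_at e js'"
  shows "k_linear (algA sc) (projQ e js) (projQ e js') (Tdelta e f js js' B)"
  by (rule k_linearI)
     (auto simp: Tdelta_closed[OF assms] fun_eq_iff Tdelta_apply f_add distrib_right sum.distrib
        kact_projQ f_scale scale_sum scale_mult(1))

text \<open>
  This is the cocycle identity for \<open>f\<close>, applied to \<open>a\<close>, the entries \<open>x\<^sub>k\<close> of \<open>x\<close> and those of the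
  matrix: of its four terms, \<open>f(a \<otimes> x\<^sub>k b\<^sub>k\<^sub>s)\<close> and \<open>f(a \<otimes> x\<^sub>k) b\<^sub>k\<^sub>s\<close> give the two on the right.
\<close>

lemma Tdelta_twisted:
  assumes js: "idempotents_at e js" and js': "idempotents_at e js'"
    and B: "is_matrix_of e js js' B d" and d: "lmod_hom (projQ e js) (projQ e js') d"
    and x: "x \<in> mcar (projQ e js)"
  shows "Tdelta e f js js' B (mact (projQ e js) a x) - mact (projQ e js') a (Tdelta e f js js' B x)
    = fQ e f js' a (d x) - d (fQ e f js a x)"
proof
  fix s
  show "(Tdelta e f js js' B (mact (projQ e js) a x) - mact (projQ e js') a (Tdelta e f js js' B x)) s
    = (fQ e f js' a (d x) - d (fQ e f js a x)) s"
  proof (cases "s < length js'")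
    case False
    then have "d (fQ e f js a x) s = 0"
      using lmod_homD(1)[OF d fQ_closed[OF js]] by (auto simp: projQ_iff[OF js'])
    with False show ?thesis by (simp add: Tdelta_apply mact_projQ fQ_def)
  next
    case True
    let ?e = "e (js' ! s)"
    have "Tdelta e f js js' B (mact (projQ e js) a x) s - (mact (projQ e js') a (Tdelta e f js js' B x)) s
      = (\<Sum>k<length js. f (a * x k) (B k s) - a * f (x k) (B k s)) * ?e"
      using True
      by (simp add: Tdelta_apply mact_projQ sum_subtractf left_diff_distrib sum_distrib_left flip: mult.assoc)
    also have "(\<Sum>k<length js. f (a * x k) (B k s) - a * f (x k) (B k s))
      = (\<Sum>k<length js. f a (x k * B k s) - f a (x k) * B k s)"
      by (intro sum.cong) (auto simp: f_cocycle algebra_simps)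
    also have "\<dots> * ?e = f a (d x s) * ?e - (\<Sum>k<length js. f a (x k) * (B k s * ?e))"
      using True x is_matrix_ofD(3)[OF B js js']
      by (simp add: sum_subtractf left_diff_distrib sum_distrib_right f_sum_right mult.assoc)
    also have "(\<Sum>k<length js. f a (x k) * (B k s * ?e)) = (\<Sum>k<length js. fQ e f js a x k * B k s)"
      using True is_matrix_ofD(1,2)[OF B js js']
      by (intro sum.cong) (auto simp: fQ_def mult.assoc)
    also have "\<dots> = d (fQ e f js a x) s"
      using True is_matrix_ofD(3)[OF B js js' fQ_closed[OF js]] by simp
    finally show ?thesis using True by (simp add: fQ_def)
  qed
qed

end

section \<open>The homotopies\<close>

lemma sign_power_simps [simp]:
  "sign_power 0 x = x" "sign_power (Suc j) x = - sign_power j x" "sign_power j 0 = 0"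
  "sign_power j (sign_power j x) = x"
  by (simp_all add: sign_power_def)

lemma sign_power_distrib:
  "sign_power j (x + y) = sign_power j x + sign_power j y"
  "sign_power j (x - y) = sign_power j x - sign_power j y"
  "sign_power j (- x) = - sign_power j x"
  by (simp_all add: sign_power_def)

lemma (in left_module) sign_power_closed: "x \<in> mcar M \<Longrightarrow> sign_power j x \<in> mcar M"
  by (simp add: sign_power_def minus_closed)

lemma (in left_module) act_sign_power: "x \<in> mcar M \<Longrightarrow> mact M a (sign_power j x) = sign_power j (mact M a x)"
  by (simp add: sign_power_def act_minus_right)

text \<open>
  The set \<open>K i\<close> is the syzygy in \<open>Q\<^sub>i\<close>, which is both a kernel and an image. Replacing the
  augmentation by its kernel \<open>K 0\<close> allows degree \<open>0\<close> to be treated like the others, although the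
  augmentation has values in another type than the \<open>\<delta> i\<close>.
\<close>

locale twisted_resolution = deformation sc f
  for sc :: "'k::field \<Rightarrow> 'a \<Rightarrow> 'a::{ring,monoid_mult}" and f :: "'a \<Rightarrow> 'a \<Rightarrow> 'a" +
  fixes e :: "nat \<Rightarrow> 'a" and js :: "nat \<Rightarrow> nat list"
    and \<delta> :: "nat \<Rightarrow> (nat \<Rightarrow> 'a) \<Rightarrow> (nat \<Rightarrow> 'a)" and K :: "nat \<Rightarrow> (nat \<Rightarrow> 'a) set"
  assumes idem: "idempotents_at e (js i)"
    and fd: "fd_module (algA sc) (projQ e (js i))"
    and \<delta>_hom: "lmod_hom (projQ e (js (Suc i))) (projQ e (js i)) (\<delta> (Suc i))"
    and \<delta>_image: "\<delta> (Suc i) ` mcar (projQ e (js (Suc i))) = K i"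
    and K_Suc: "K (Suc i) = {x \<in> mcar (projQ e (js (Suc i))). \<delta> (Suc i) x = 0}"
    and K_superfluous: "superfluous (algA sc) (projQ e (js i)) (K i)"
    and starA: "\<exists>B. is_matrix_of e (js 1) (js 0) B (\<delta> 1) \<and>
      Tdelta e f (js 1) (js 0) B ` mcar (projQ e (js 1)) \<subseteq> K 0"
begin

abbreviation Q :: "nat \<Rightarrow> ('a, nat \<Rightarrow> 'a) lmod" where
  "Q i \<equiv> projQ e (js i)"

abbreviation fQi :: "nat \<Rightarrow> 'a \<Rightarrow> (nat \<Rightarrow> 'a) \<Rightarrow> (nat \<Rightarrow> 'a)" where
  "fQi i \<equiv> fQ e f (js i)"

sublocale Q: left_module "algA sc" "Q i" for i
  by (rule left_module_projQ)

sublocale K: left_module "algA sc" "Q i\<lparr>mcar := K i\<rparr>" for i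
  using K_superfluous[of i] by (simp add: superfluous_def submodule_def)

lemma K_subset: "K i \<subseteq> mcar (Q i)"
  using K_superfluous[of i] by (simp add: superfluous_def submodule_def)

lemmas \<delta>_closed = lmod_homD(1)[OF \<delta>_hom] and \<delta>_add = lmod_homD(2)[OF \<delta>_hom]
  and \<delta>_act = lmod_homD(3)[OF \<delta>_hom]

lemma \<delta>_diff: "x \<in> mcar (Q (Suc i)) \<Longrightarrow> y \<in> mcar (Q (Suc i)) \<Longrightarrow> \<delta> (Suc i) (x - y) = \<delta> (Suc i) x - \<delta> (Suc i) y"
  using Q.additive_diff[of "Suc i" "\<delta> (Suc i)", OF \<delta>_add] .

lemma \<delta>_minus: "x \<in> mcar (Q (Suc i)) \<Longrightarrow> \<delta> (Suc i) (- x) = - \<delta> (Suc i) x"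
  using Q.additive_minus[of "Suc i" "\<delta> (Suc i)", OF \<delta>_add] .

lemma \<delta>_sign: "x \<in> mcar (Q (Suc i)) \<Longrightarrow> \<delta> (Suc i) (sign_power j x) = sign_power j (\<delta> (Suc i) x)"
  by (simp add: sign_power_def \<delta>_minus)

lemma \<delta>_in_K: "x \<in> mcar (Q (Suc i)) \<Longrightarrow> \<delta> (Suc i) x \<in> K i"
  using \<delta>_image[of i] by blast

lemma \<delta>_\<delta>: "x \<in> mcar (Q (Suc (Suc i))) \<Longrightarrow> \<delta> (Suc i) (\<delta> (Suc (Suc i)) x) = 0"
  using \<delta>_in_K[of x "Suc i"] by (simp add: K_Suc)

text \<open>
  This is the condition on \<open>T\<^sub>i\<^sub>+\<^sub>1 : Q\<^sub>i\<^sub>+\<^sub>1 \<rightarrow> Q\<^sub>i\<close>, whose sign \<open>(-1)\<^sup>i\<^sup>+\<^sup>2\<close> is \<open>(-1)\<^sup>i\<close>.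
\<close>

definition twisted :: "nat \<Rightarrow> ((nat \<Rightarrow> 'a) \<Rightarrow> (nat \<Rightarrow> 'a)) \<Rightarrow> bool" where
  "twisted i T \<longleftrightarrow> k_linear (algA sc) (Q (Suc i)) (Q i) T \<and>
     (\<forall>a. \<forall>x\<in>mcar (Q (Suc i)). T (mact (Q (Suc i)) a x) =
       mact (Q i) a (T x) + sign_power i (fQi i a (\<delta> (Suc i) x) - \<delta> (Suc i) (fQi (Suc i) a x)))"

lemma twistedD:
  assumes "twisted i T"
  shows "x \<in> mcar (Q (Suc i)) \<Longrightarrow> T x \<in> mcar (Q i)"
    and "x \<in> mcar (Q (Suc i)) \<Longrightarrow> y \<in> mcar (Q (Suc i)) \<Longrightarrow> T (x + y) = T x + T y"
    and "x \<in> mcar (Q (Suc i)) \<Longrightarrow> T (mact (Q (Suc i)) a x) =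
       mact (Q i) a (T x) + sign_power i (fQi i a (\<delta> (Suc i) x) - \<delta> (Suc i) (fQi (Suc i) a x))"
  using assms by (auto simp: twisted_def k_linear_def)

lemma twisted_zero: "twisted i T \<Longrightarrow> T 0 = 0"
  by (rule additive_on_zero[OF Q.zero_closed]) (rule twistedD)

lemma twisted_sign_Tdelta:
  assumes "is_matrix_of e (js (Suc i)) (js i) B (\<delta> (Suc i))"
  shows "twisted i (\<lambda>x. sign_power i (Tdelta e f (js (Suc i)) (js i) B x))"
proof -
  let ?T = "Tdelta e f (js (Suc i)) (js i) B"
  have lin: "k_linear (algA sc) (Q (Suc i)) (Q i) ?T" by (rule Tdelta_linear[OF idem])
  have "k_linear (algA sc) (Q (Suc i)) (Q i) (\<lambda>x. sign_power i (?T x))"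
    unfolding sign_power_def
    using lin k_linear_minus[OF Q.left_module_axioms lin] by (cases "even i") simp_all
  moreover have "?T (mact (Q (Suc i)) a x)
      = mact (Q i) a (?T x) + (fQi i a (\<delta> (Suc i) x) - \<delta> (Suc i) (fQi (Suc i) a x))"
    if "x \<in> mcar (Q (Suc i))" for a x
    using Tdelta_twisted[OF idem idem assms \<delta>_hom that, of a] by (simp add: algebra_simps)
  ultimately show ?thesis
    by (simp add: twisted_def Q.act_sign_power Tdelta_closed[OF idem] sign_power_distrib)
qed

text \<open>
  The twisted maps \<open>Q\<^sub>i\<^sub>+\<^sub>1 \<rightarrow> Q\<^sub>i\<close> form a coset of the homomorphisms, so the map \<open>\<plusminus>T\<^sub>\<delta>\<close>
  may be corrected by a homomorphism. The defect of the required commutation is a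
  homomorphism, the two twists cancelling because of their opposite signs; it takes values in the
  preceding syzygy, and projectivity lifts it.
\<close>

lemma twisted_extend:
  assumes T: "twisted i T" and TK: "T ` K (Suc i) \<subseteq> K i"
  shows "\<exists>T'. (twisted (Suc i) T' \<and> T' ` K (Suc (Suc i)) \<subseteq> K (Suc i)) \<and>
    (\<forall>x\<in>mcar (Q (Suc (Suc i))). T (\<delta> (Suc (Suc i)) x) = \<delta> (Suc i) (T' x))"
proof -
  obtain B where "is_matrix_of e (js (Suc (Suc i))) (js (Suc i)) B (\<delta> (Suc (Suc i)))"
    using lmod_hom_has_matrix[OF idem idem \<delta>_hom] by blast
  then obtain U where U: "twisted (Suc i) U" using twisted_sign_Tdelta by blast
  let ?D = "\<lambda>x. T (\<delta> (Suc (Suc i)) x) - \<delta> (Suc i) (U x)"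
  have D: "lmod_hom (Q (Suc (Suc i))) (Q i) ?D"
  proof (rule lmod_homI)
    fix a x assume x: "x \<in> mcar (Q (Suc (Suc i)))"
    let ?w = "\<delta> (Suc i) (fQi (Suc i) a (\<delta> (Suc (Suc i)) x))"
    have "T (\<delta> (Suc (Suc i)) (mact (Q (Suc (Suc i))) a x))
      = mact (Q i) a (T (\<delta> (Suc (Suc i)) x)) - sign_power i ?w"
      using x by (simp add: \<delta>_act twistedD(3)[OF T] \<delta>_closed \<delta>_\<delta> sign_power_distrib)
    moreover have "\<delta> (Suc i) (U (mact (Q (Suc (Suc i))) a x))
      = mact (Q i) a (\<delta> (Suc i) (U x)) - sign_power i ?w"
    proof -
      have "\<delta> (Suc i) (sign_power (Suc i) (fQi (Suc i) a (\<delta> (Suc (Suc i)) x)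
          - \<delta> (Suc (Suc i)) (fQi (Suc (Suc i)) a x))) = - sign_power i ?w"
        using x by (simp add: \<delta>_sign \<delta>_minus \<delta>_diff \<delta>_closed \<delta>_\<delta> fQ_closed[OF idem]
            Q.diff_closed Q.sign_power_closed)
      moreover have "\<delta> (Suc i) (mact (Q (Suc i)) a (U x)) = mact (Q i) a (\<delta> (Suc i) (U x))"
        using x by (simp add: \<delta>_act twistedD(1)[OF U])
      ultimately show ?thesis
        unfolding twistedD(3)[OF U x]
        using x by (subst \<delta>_add) (auto simp: twistedD(1)[OF U] Q.act_closed
            intro!: Q.sign_power_closed Q.minus_closed Q.diff_closed fQ_closed[OF idem] \<delta>_closed)
    qed
    ultimately show "?D (mact (Q (Suc (Suc i))) a x) = mact (Q i) a (?D x)"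
      using x by (simp add: Q.act_diff_right twistedD(1)[OF T] twistedD(1)[OF U] \<delta>_closed)
  qed (auto simp: \<delta>_add \<delta>_closed twistedD[OF T] twistedD(1,2)[OF U] intro!: Q.diff_closed)
  have D_K: "?D x \<in> K i" if "x \<in> mcar (Q (Suc (Suc i)))" for x
    using K.diff_closed[of "T (\<delta> (Suc (Suc i)) x)" i "\<delta> (Suc i) (U x)"] TK that
      \<delta>_in_K[of "U x" i] \<delta>_in_K[of x "Suc i"] twistedD(1)[OF U that] by auto
  have "?D (generator e (js (Suc (Suc i))) r) \<in> \<delta> (Suc i) ` mcar (Q (Suc i))"
    if "r \<in> {..<length (js (Suc (Suc i)))}" for r
    using D_K[OF generator_closed[OF idem, of r "Suc (Suc i)"]] that by (simp add: \<delta>_image)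
  with dual_basis_lift[OF Q.left_module_axioms Q.left_module_axioms Q.left_module_axioms
      dual_basis_projQ[OF idem] \<delta>_hom D]
  obtain H where H: "lmod_hom (Q (Suc (Suc i))) (Q (Suc i)) H"
    "\<And>x. x \<in> mcar (Q (Suc (Suc i))) \<Longrightarrow> \<delta> (Suc i) (H x) = ?D x" by blast
  let ?T' = "\<lambda>x. U x + H x"
  have tw: "twisted (Suc i) ?T'"
    unfolding twisted_def
  proof (intro conjI allI ballI)
    show "k_linear (algA sc) (Q (Suc (Suc i))) (Q (Suc i)) ?T'"
      using U by (intro k_linear_add[OF Q.left_module_axioms _ lmod_hom_k_linear[OF H(1)]])
        (simp add: twisted_def)
  qed (simp add: twistedD(3)[OF U] lmod_homD[OF H(1)] twistedD(1)[OF U] Q.act_add_right algebra_simps)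
  have comm: "T (\<delta> (Suc (Suc i)) x) = \<delta> (Suc i) (?T' x)" if "x \<in> mcar (Q (Suc (Suc i)))" for x
    using that by (simp add: \<delta>_add twistedD(1)[OF U] lmod_homD(1)[OF H(1)] H(2))
  have "?T' x \<in> K (Suc i)" if "x \<in> K (Suc (Suc i))" for x
    using comm[of x] twistedD(1)[OF tw, of x] that twisted_zero[OF T] by (simp add: K_Suc)
  with tw comm show ?thesis by blast
qed

lemma homotopies_exist:
  "\<exists>T. \<forall>i. twisted i (T (Suc i)) \<and> T (Suc i) ` K (Suc i) \<subseteq> K i \<and>
    (\<forall>x\<in>mcar (Q (Suc (Suc i))). T (Suc i) (\<delta> (Suc (Suc i)) x) = \<delta> (Suc i) (T (Suc (Suc i)) x))"
proof -
  obtain B where B: "is_matrix_of e (js 1) (js 0) B (\<delta> 1)"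
    "Tdelta e f (js 1) (js 0) B ` mcar (Q 1) \<subseteq> K 0" using starA by blast
  have "twisted 0 (Tdelta e f (js 1) (js 0) B)"
    using twisted_sign_Tdelta[of 0 B] B(1) by simp
  moreover have "Tdelta e f (js 1) (js 0) B ` K 1 \<subseteq> K 0" using B(2) K_subset[of 1] by blast
  ultimately have "\<exists>T. twisted 0 T \<and> T ` K (Suc 0) \<subseteq> K 0" by auto
  then have "\<exists>g. \<forall>i. (twisted i (g i) \<and> g i ` K (Suc i) \<subseteq> K i) \<and>
    (\<forall>x\<in>mcar (Q (Suc (Suc i))). g i (\<delta> (Suc (Suc i)) x) = \<delta> (Suc i) (g (Suc i) x))"
    by (rule dependent_nat_choice) (rule twisted_extend, blast+)
  then obtain g where g: "\<forall>i. (twisted i (g i) \<and> g i ` K (Suc i) \<subseteq> K i) \<and>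
    (\<forall>x\<in>mcar (Q (Suc (Suc i))). g i (\<delta> (Suc (Suc i)) x) = \<delta> (Suc i) (g (Suc i) x))" ..
  show ?thesis
  proof (intro exI[of _ "\<lambda>i. g (i - 1)"] allI)
    fix i
    show "twisted i (g (Suc i - 1)) \<and> g (Suc i - 1) ` K (Suc i) \<subseteq> K i \<and>
      (\<forall>x\<in>mcar (Q (Suc (Suc i))).
        g (Suc i - 1) (\<delta> (Suc (Suc i)) x) = \<delta> (Suc i) (g (Suc (Suc i) - 1) x))"
      unfolding diff_Suc_1 using spec[OF g, of i] unfolding conj_assoc .
  qed
qed

end

section \<open>The resolution over the deformed algebra\<close>

lemma Phat_simps:
  "tup0 (Phat e f js m) = direct_sum {0..m} (\<lambda>i. projQ e (js i))"
  "tup1 (Phat e f js m) = direct_sum {0..m} (\<lambda>i. projQ e (js i))"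
  "tupT (Phat e f js m) = (\<lambda>x i. if i \<in> {0..m} then x i else 0)"
  "tupf (Phat e f js m) = (\<lambda>a x i. if i \<in> {0..m} then fQ e f (js i) a (x i) else 0)"
  by (simp_all add: Phat_def tuple_sum_def hatQ_def fun_eq_iff)

lemma kact_direct_sum:
  "kact A (direct_sum I N) c x = (\<lambda>i. if i \<in> I then kact A (N i) c (x i) else 0)"
  by (simp add: kact_def fun_eq_iff)

lemma (in left_module) kact_simps:
  "x \<in> mcar M \<Longrightarrow> kact A M c x \<in> mcar M"
  "x \<in> mcar M \<Longrightarrow> y \<in> mcar M \<Longrightarrow> kact A M c (x + y) = kact A M c x + kact A M c y"
  "x \<in> mcar M \<Longrightarrow> kact A M c (sign_power j x) = sign_power j (kact A M c x)"
  by (simp_all add: kact_def act_closed act_add_right act_sign_power)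

locale twisted_resolution_homotopies = twisted_resolution sc f e js \<delta> K
  for sc :: "'k::field \<Rightarrow> 'a \<Rightarrow> 'a::{ring,monoid_mult}" and f :: "'a \<Rightarrow> 'a \<Rightarrow> 'a"
    and e :: "nat \<Rightarrow> 'a" and js :: "nat \<Rightarrow> nat list"
    and \<delta> :: "nat \<Rightarrow> (nat \<Rightarrow> 'a) \<Rightarrow> (nat \<Rightarrow> 'a)" and K :: "nat \<Rightarrow> (nat \<Rightarrow> 'a) set" +
  fixes T :: "nat \<Rightarrow> (nat \<Rightarrow> 'a) \<Rightarrow> (nat \<Rightarrow> 'a)"
  assumes T_twisted: "twisted i (T (Suc i))"
    and T_K: "T (Suc i) ` K (Suc i) \<subseteq> K i"
    and T_\<delta>: "x \<in> mcar (Q (Suc (Suc i))) \<Longrightarrow>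
      T (Suc i) (\<delta> (Suc (Suc i)) x) = \<delta> (Suc i) (T (Suc (Suc i)) x)"
begin

abbreviation D :: "nat \<Rightarrow> ('a, nat \<Rightarrow> nat \<Rightarrow> 'a) lmod" where
  "D m \<equiv> direct_sum {0..m} Q"

abbreviation P :: "nat \<Rightarrow> ('a, nat \<Rightarrow> nat \<Rightarrow> 'a, nat \<Rightarrow> nat \<Rightarrow> 'a) tup" where
  "P m \<equiv> Phat e f js m"

abbreviation hat :: "nat \<Rightarrow> (nat \<Rightarrow> nat \<Rightarrow> 'a) \<times> (nat \<Rightarrow> nat \<Rightarrow> 'a) \<Rightarrow> (nat \<Rightarrow> nat \<Rightarrow> 'a) \<times> (nat \<Rightarrow> nat \<Rightarrow> 'a)" where
  "hat m \<equiv> triple_map (hat_delta \<delta> T m)"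

lemmas T_closed = twistedD(1)[OF T_twisted] and T_add = twistedD(2)[OF T_twisted]
  and T_act = twistedD(3)[OF T_twisted] and T_zero = twisted_zero[OF T_twisted]

lemma T_kact: "x \<in> mcar (Q (Suc i)) \<Longrightarrow>
    T (Suc i) (kact (algA sc) (Q (Suc i)) c x) = kact (algA sc) (Q i) c (T (Suc i) x)"
  using T_twisted[of i] by (simp add: twisted_def k_linear_def)

lemma hat_apply: "hat m (x, y) = (umap \<delta> m x, vmap T m x + umap \<delta> m y)"
  by (simp add: hat_delta_def triple_map_def)

lemma is_tuple_P: "is_tuple sc f (P m)"
  unfolding Phat_def by (intro is_tuple_tuple_sum is_tuple_hatQ idem fd) simp

sublocale P: deformation_tuple sc f "P m" for m
  by standard (rule is_tuple_P)

lemma is_triple_hat: "is_triple sc (P (Suc m)) (P m) (hat_delta \<delta> T (Suc m))"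
  unfolding is_triple_def hat_delta_def prod.case Phat_simps
proof (intro conjI ballI allI)
  show u: "lmod_hom (D (Suc m)) (D m) (umap \<delta> (Suc m))"
    by (rule lmod_homI) (auto simp: umap_def \<delta>_closed \<delta>_add \<delta>_act fun_eq_iff[where 'b = "nat \<Rightarrow> 'a"])
  then show "lmod_hom (D (Suc m)) (D m) (umap \<delta> (Suc m))" .
  show "k_linear (algA sc) (D (Suc m)) (D m) (vmap T (Suc m))"
    by (rule k_linearI)
       (auto simp: vmap_def T_closed T_add T_kact kact_direct_sum Q.kact_simps sign_power_distrib Q.sign_power_closed
          fun_eq_iff[where 'b = "nat \<Rightarrow> 'a"] intro!: Q.sign_power_closed Q.add_closed)
next
  fix a x assume x: "x \<in> mcar (D (Suc m))"
  show "vmap T (Suc m) (mact (D (Suc m)) a x) = mact (D m) a (vmap T (Suc m) x)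
      - umap \<delta> (Suc m) (\<lambda>i. if i \<in> {0..Suc m} then fQi i a (x i) else 0)
      + (\<lambda>i. if i \<in> {0..m} then fQi i a (umap \<delta> (Suc m) x i) else 0)"
  proof
    fix j
    show "vmap T (Suc m) (mact (D (Suc m)) a x) j = (mact (D m) a (vmap T (Suc m) x)
      - umap \<delta> (Suc m) (\<lambda>i. if i \<in> {0..Suc m} then fQi i a (x i) else 0)
      + (\<lambda>i. if i \<in> {0..m} then fQi i a (umap \<delta> (Suc m) x i) else 0)) j"
    proof (cases "j \<le> m")
      case True
      then have "x j \<in> mcar (Q j)" "x (Suc j) \<in> mcar (Q (Suc j))" using x by auto
      then show ?thesis
        using True
        by (simp add: vmap_def umap_def T_act T_closed Q.act_sign_power Q.act_add_right Q.add_closed Q.sign_power_closed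
            sign_power_distrib algebra_simps)
    qed (simp add: vmap_def umap_def)
  qed
qed (auto simp: umap_def fun_eq_iff)

lemmas hom_hat = lmod_hom_triple_map[OF is_tuple_P is_tuple_P is_triple_hat]

subsection \<open>Projectivity\<close>

text \<open>
  The idempotent \<open>u\<close> of \<open>A\<close> lifts to the idempotent \<open>v = u + (f(u \<otimes> u) - 2 u f(u \<otimes> u))t\<close> of \<open>A\<^sub>f\<close>.
  This map is the isomorphism of the tuple \<open>(Au, Au, Id, f\<^sub>A\<^sub>u)\<close> with the left ideal \<open>A\<^sub>f v\<close> that
  sends the generator \<open>(u, 0)\<close> to \<open>v\<close>.
\<close>

definition hat_coordinate :: "'a \<Rightarrow> 'a \<Rightarrow> 'a \<Rightarrow> 'a \<times> 'a" where
  "hat_coordinate u x y = (x, y + f x u - f x u * u - f x u * u)"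

lemma hat_coordinate_act:
  assumes "u * u = u" "x * u = x"
  shows "hat_coordinate u (a * x) (a * y + b * x + f a x * u) =
    amult (algAf sc f) (a, b) (hat_coordinate u x y)"
proof -
  have 1: "f (a * x) u = a * f x u + f a x - f a x * u"
    using f_cocycle[of a x u] assms(2) by (simp add: algebra_simps)
  have 2: "f (a * x) u * u = a * (f x u * u)"
    unfolding 1 by (simp add: algebra_simps assms(1))
  show ?thesis
    unfolding hat_coordinate_def algAf_simps 2 by (simp add: 1 algebra_simps)
qed

text \<open>
  The generators are the elements \<open>(u, 0)\<close>, one for each summand \<open>Au\<close> of each \<open>Q\<^sub>i\<close>; multiplying
  \<open>(u, 0)\<close> by its coordinate at \<open>(x, y)\<close> gives back \<open>(x, y)\<close>, for \<open>x\<close> and \<open>y\<close> in \<open>Au\<close>.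
\<close>

lemma dual_basis_P:
  "dual_basis (algAf sc f) (tuple_module (P m)) (Sigma {0..m} (\<lambda>i. {..<length (js i)}))
    (\<lambda>(i, r). (single i (generator e (js i) r), 0))
    (\<lambda>(i, r) (x, y). hat_coordinate (e (js i ! r)) (x i r) (y i r))"
  unfolding dual_basis_def
proof (intro conjI ballI)
  show "finite (Sigma {0..m} (\<lambda>i. {..<length (js i)}))" by simp
  show "(\<lambda>(i, r). (single i (generator e (js i) r), 0)) ` Sigma {0..m} (\<lambda>i. {..<length (js i)})
      \<subseteq> mcar (tuple_module (P m))"
    by (auto simp: Phat_simps single_def generator_closed[OF idem] Q.zero_closed)
  have uu: "e (js i ! r) * e (js i ! r) = e (js i ! r)" if "r < length (js i)" for i r
    using idem[of i] that by (simp add: idempotents_at_def)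
  show "lmod_hom (tuple_module (P m)) (regular_module (algAf sc f))
      ((\<lambda>(i, r) (x, y). hat_coordinate (e (js i ! r)) (x i r) (y i r)) k)"
    if k: "k \<in> Sigma {0..m} (\<lambda>i. {..<length (js i)})" for k
  proof -
    obtain i r where ir: "k = (i, r)" "i \<le> m" "r < length (js i)" using k by auto
    show ?thesis
      unfolding ir prod.case
    proof (rule lmod_homI)
      fix c :: "'a \<times> 'a" and p assume "p \<in> mcar (tuple_module (P m))"
      then obtain x y where p: "p = (x, y)" "x i \<in> mcar (Q i)" "y i \<in> mcar (Q i)"
        using ir(2) by (cases p) (auto simp: Phat_simps)
      obtain a b where c: "c = (a, b)" by (cases c)
      have "x i r * e (js i ! r) = x i r" using p(2) ir(3) by (simp add: projQ_iff[OF idem])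
      then show "(case mact (tuple_module (P m)) c p of (x, y) \<Rightarrow> hat_coordinate (e (js i ! r)) (x i r) (y i r))
        = mact (regular_module (algAf sc f)) c (case p of (x, y) \<Rightarrow> hat_coordinate (e (js i ! r)) (x i r) (y i r))"
        using hat_coordinate_act[OF uu[OF ir(3)], of "x i r" a "y i r" b] ir
        by (simp add: p(1) c Phat_simps mact_projQ fQ_def regular_module_def)
    qed (auto simp: regular_module_def hat_coordinate_def f_add algebra_simps)
  qed
  fix p assume "p \<in> mcar (tuple_module (P m))"
  then obtain x y where p: "p = (x, y)" and x: "x \<in> mcar (D m)" and y: "y \<in> mcar (D m)"
    by (cases p) (auto simp: Phat_simps)
  have double: "z = (\<Sum>i=0..m. \<Sum>r<length (js i). single i (single r (z i r)))"
    if z: "z \<in> mcar (D m)" for z :: "nat \<Rightarrow> nat \<Rightarrow> 'a"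
  proof -
    have "z = (\<Sum>i=0..m. single i (z i))" using z by (intro sum_single) auto
    also have "\<dots> = (\<Sum>i=0..m. \<Sum>r<length (js i). single i (single r (z i r)))"
    proof (rule sum.cong[OF refl])
      fix i assume "i \<in> {0..m}"
      then have "z i = (\<Sum>r<length (js i). single r (z i r))"
        using z by (intro sum_single) (auto simp: projQ_iff[OF idem])
      then have "single i (z i) = single i (\<Sum>r<length (js i). single r (z i r))" by simp
      also have "\<dots> = (\<Sum>r<length (js i). single i (single r (z i r)))"
        by (auto simp: single_def fun_eq_iff sum_fun_apply)
      finally show "single i (z i) = (\<Sum>r<length (js i). single i (single r (z i r)))" .
    qed
    finally show ?thesis .
  qed
  have summand: "mact (tuple_module (P m)) (hat_coordinate (e (js i ! r)) (x i r) (y i r))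
      (single i (generator e (js i) r), 0) = (single i (single r (x i r)), single i (single r (y i r)))"
    if i: "i \<in> {0..m}" and r: "r < length (js i)" for i r
  proof -
    let ?u = "e (js i ! r)"
    have "x i r * ?u = x i r" "y i r * ?u = y i r"
      using x y i r by (auto simp: projQ_iff[OF idem])
    then show ?thesis
      using i r uu[OF r]
      by (auto simp: hat_coordinate_def Phat_simps mact_projQ fQ_def generator_def single_def
          fun_eq_iff algebra_simps)
  qed
  have "p = (\<Sum>i=0..m. \<Sum>r<length (js i). (single i (single r (x i r)), single i (single r (y i r))))"
    unfolding p sum_prod using double[OF x] double[OF y] by simp
  also have "\<dots> = (\<Sum>i=0..m. \<Sum>r<length (js i). mact (tuple_module (P m))
      (hat_coordinate (e (js i ! r)) (x i r) (y i r)) (single i (generator e (js i) r), 0))"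
    by (intro sum.cong refl summand[symmetric]) auto
  also have "\<dots> = (\<Sum>k\<in>Sigma {0..m} (\<lambda>i. {..<length (js i)}). mact (tuple_module (P m))
      ((\<lambda>(i, r) (x, y). hat_coordinate (e (js i ! r)) (x i r) (y i r)) k p)
      ((\<lambda>(i, r). (single i (generator e (js i) r), 0)) k))"
    by (simp add: sum.Sigma p split_def)
  finally show "p = (\<Sum>k\<in>Sigma {0..m} (\<lambda>i. {..<length (js i)}). mact (tuple_module (P m))
      ((\<lambda>(i, r) (x, y). hat_coordinate (e (js i ! r)) (x i r) (y i r)) k p)
      ((\<lambda>(i, r). (single i (generator e (js i) r), 0)) k))" .
qed

lemma projective_P: "projective (algAf sc f) (tuple_module (P m))"
  by (rule projective_dual_basis[OF P.fd_module_tuple dual_basis_P])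

subsection \<open>Exactness\<close>

text \<open>
  This is the kernel of the map starting in degree \<open>m\<close>, written out in components. The condition
  on \<open>x m\<close> makes it correct for \<open>m = 0\<close> also, where the map is the augmentation; for positive \<open>m\<close> it
  says that \<open>\<delta> m (x m) = 0\<close>.
\<close>

definition cycles :: "nat \<Rightarrow> ((nat \<Rightarrow> nat \<Rightarrow> 'a) \<times> (nat \<Rightarrow> nat \<Rightarrow> 'a)) set" where
  "cycles m = {(x, y). x \<in> mcar (D m) \<and> y \<in> mcar (D m) \<and> x m \<in> K m \<and>
     (\<forall>j<m. \<delta> (Suc j) (x (Suc j)) = 0 \<and>
        sign_power j (x j + T (Suc j) (x (Suc j))) + \<delta> (Suc j) (y (Suc j)) = 0)}"

lemma kernel_hat: "{p \<in> mcar (tuple_module (P (Suc m))). hat (Suc m) p = 0} = cycles (Suc m)"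
proof -
  have "hat (Suc m) (x, y) = 0 \<longleftrightarrow> (\<forall>j<Suc m. \<delta> (Suc j) (x (Suc j)) = 0 \<and>
      sign_power j (x j + T (Suc j) (x (Suc j))) + \<delta> (Suc j) (y (Suc j)) = 0)" for x y
  proof -
    have "umap \<delta> (Suc m) x = 0 \<longleftrightarrow> (\<forall>j<Suc m. \<delta> (Suc j) (x (Suc j)) = 0)"
      by (auto simp: umap_def fun_eq_iff[where 'b = "nat \<Rightarrow> 'a"] simp del: less_Suc_eq_le)
    moreover have "vmap T (Suc m) x + umap \<delta> (Suc m) y = 0 \<longleftrightarrow>
        (\<forall>j<Suc m. sign_power j (x j + T (Suc j) (x (Suc j))) + \<delta> (Suc j) (y (Suc j)) = 0)"
      by (auto simp: umap_def vmap_def fun_eq_iff[where 'b = "nat \<Rightarrow> 'a"] split: if_splits)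
    ultimately show ?thesis by (auto simp: hat_apply zero_prod_def)
  qed
  then show ?thesis by (auto simp: cycles_def Phat_simps K_Suc)
qed

lemma image_hat_subset: "hat (Suc m) ` mcar (tuple_module (P (Suc m))) \<subseteq> cycles m"
proof (rule image_subsetI)
  fix p assume p: "p \<in> mcar (tuple_module (P (Suc m)))"
  obtain x y where eq: "p = (x, y)" by (cases p)
  have x: "x i \<in> mcar (Q i)" and y: "y i \<in> mcar (Q i)" if "i \<le> Suc m" for i
    using p that by (auto simp: eq Phat_simps)
  have closed: "hat (Suc m) p \<in> mcar (tuple_module (P m))" by (rule lmod_homD(1)[OF hom_hat p])
  show "hat (Suc m) p \<in> cycles m"
    unfolding eq hat_apply cycles_def mem_Collect_eq prod.case
  proof (intro conjI allI impI)
    show "umap \<delta> (Suc m) x \<in> mcar (D m)" "vmap T (Suc m) x + umap \<delta> (Suc m) y \<in> mcar (D m)"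
      using closed by (auto simp: eq hat_apply Phat_simps)
    show "umap \<delta> (Suc m) x m \<in> K m" using \<delta>_in_K[of "x (Suc m)" m] x[of "Suc m"] by (simp add: umap_def)
  next
    fix j assume j: "j < m"
    then have xj: "x j \<in> mcar (Q j)" "x (Suc j) \<in> mcar (Q (Suc j))"
      "x (Suc (Suc j)) \<in> mcar (Q (Suc (Suc j)))" "y (Suc j) \<in> mcar (Q (Suc j))"
      "y (Suc (Suc j)) \<in> mcar (Q (Suc (Suc j)))"
      by (auto intro: x y)
    show "\<delta> (Suc j) (umap \<delta> (Suc m) x (Suc j)) = 0" using j xj by (simp add: umap_def \<delta>_\<delta>)
    have "\<delta> (Suc j) ((vmap T (Suc m) x + umap \<delta> (Suc m) y) (Suc j))
      = - sign_power j (\<delta> (Suc j) (x (Suc j)) + T (Suc j) (\<delta> (Suc (Suc j)) (x (Suc (Suc j)))))"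
    proof -
      have "\<delta> (Suc j) ((vmap T (Suc m) x + umap \<delta> (Suc m) y) (Suc j))
        = \<delta> (Suc j) (sign_power (Suc j) (x (Suc j) + T (Suc (Suc j)) (x (Suc (Suc j))))
            + \<delta> (Suc (Suc j)) (y (Suc (Suc j))))"
        using j by (simp add: vmap_def umap_def)
      also have "\<dots> = sign_power (Suc j) (\<delta> (Suc j) (x (Suc j)) + \<delta> (Suc j) (T (Suc (Suc j)) (x (Suc (Suc j)))))"
        using xj by (simp only: \<delta>_add \<delta>_sign Q.sign_power_closed Q.add_closed T_closed \<delta>_closed \<delta>_\<delta> add_0_right)
      finally show ?thesis using xj by (simp add: T_\<delta>)
    qed
    then show "sign_power j (umap \<delta> (Suc m) x j + T (Suc j) (umap \<delta> (Suc m) x (Suc j)))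
        + \<delta> (Suc j) ((vmap T (Suc m) x + umap \<delta> (Suc m) y) (Suc j)) = 0"
      using j by (simp add: umap_def)
  qed
qed

text \<open>
  A preimage of a cycle \<open>(x, y)\<close> can be chosen of the form \<open>(z, 0)\<close>. The top component of \<open>z\<close> is
  a preimage of that of \<open>x\<close>, and the equation for \<open>y\<close> then determines the others downwards; that
  \<open>z\<close> is mapped to \<open>x\<close> follows in the same order from the cycle condition.
\<close>

lemma cycles_subset_image: "cycles m \<subseteq> hat (Suc m) ` mcar (tuple_module (P (Suc m)))"
proof
  fix p assume "p \<in> cycles m"
  then obtain x y where p: "p = (x, y)" and xD: "x \<in> mcar (D m)" and yD: "y \<in> mcar (D m)"
    and top: "x m \<in> K m"
    and cyc: "\<And>j. j < m \<Longrightarrow> sign_power j (x j + T (Suc j) (x (Suc j))) + \<delta> (Suc j) (y (Suc j)) = 0"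
    by (auto simp: cycles_def)
  have x: "x i \<in> mcar (Q i)" and y: "y i \<in> mcar (Q i)" if "i \<le> m" for i
    using xD yD that by auto
  obtain w where w: "w \<in> mcar (Q (Suc m))" "\<delta> (Suc m) w = x m"
    using top unfolding \<delta>_image[symmetric] by auto
  \<comment> \<open>Downward recursion: \<open>v k\<close> is the component of \<open>z\<close> of index \<open>m + 1 - k\<close>.\<close>
  define v where "v = rec_nat w (\<lambda>k v. sign_power (m - k) (y (m - k)) - T (Suc (m - k)) v)"
  define z where "z j = (if j \<le> Suc m then v (Suc m - j) else 0)" for j
  have z_top: "z (Suc m) = w" by (simp add: z_def v_def)
  have z_step: "z j = sign_power j (y j) - T (Suc j) (z (Suc j))" if "j \<le> m" for j
    using that by (simp add: z_def v_def Suc_diff_le)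
  have z: "z j \<in> mcar (Q j)" if "j \<le> Suc m" for j
    using that
  proof (induction rule: inc_induct)
    case base
    then show ?case using w by (simp add: z_top)
  next
    case (step j)
    then have j: "j \<le> m" by simp
    show ?case
      unfolding z_step[OF j]
      by (rule Q.diff_closed[OF Q.sign_power_closed[OF y[OF j]] T_closed[OF step.IH]])
  qed
  have \<delta>z: "\<delta> (Suc j) (z (Suc j)) = x j" if "j \<le> m" for j
    using that
  proof (induction rule: inc_induct)
    case base
    then show ?case using w by (simp add: z_top)
  next
    case (step j)
    have mem: "z (Suc (Suc j)) \<in> mcar (Q (Suc (Suc j)))" "y (Suc j) \<in> mcar (Q (Suc j))"
      using step z y by auto
    have "\<delta> (Suc j) (z (Suc j)) = sign_power (Suc j) (\<delta> (Suc j) (y (Suc j)))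
        - \<delta> (Suc j) (T (Suc (Suc j)) (z (Suc (Suc j))))"
      using step.hyps mem by (simp add: z_step \<delta>_diff \<delta>_sign \<delta>_minus Q.minus_closed Q.sign_power_closed T_closed)
    also have "\<dots> = - sign_power j (\<delta> (Suc j) (y (Suc j))) - T (Suc j) (x (Suc j))"
      using step mem by (simp flip: T_\<delta>)
    also have "\<delta> (Suc j) (y (Suc j)) = - sign_power j (x j + T (Suc j) (x (Suc j)))"
      using cyc[of j] step.hyps by (simp add: eq_neg_iff_add_eq_0 add.commute)
    finally show ?case
      by (simp only: sign_power_distrib(3) sign_power_simps(4) minus_minus add_diff_cancel_right')
  qed
  have "(z, 0) \<in> mcar (tuple_module (P (Suc m)))"
    using z by (auto simp: Phat_simps z_def Q.zero_closed)
  moreover have "hat (Suc m) (z, 0) = p"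
  proof -
    have "\<delta> (Suc j) 0 = 0" for j using \<delta>_diff[OF Q.zero_closed Q.zero_closed] by simp
    then have "umap \<delta> (Suc m) (0 :: nat \<Rightarrow> nat \<Rightarrow> 'a) = 0" by (simp add: umap_def fun_eq_iff[where 'b = "nat \<Rightarrow> 'a"])
    moreover have "umap \<delta> (Suc m) z = x"
      using xD by (auto simp: umap_def \<delta>z fun_eq_iff[where 'b = "nat \<Rightarrow> 'a"] less_Suc_eq_le)
    moreover have "vmap T (Suc m) z = y"
      using yD z_step by (auto simp: vmap_def fun_eq_iff[where 'b = "nat \<Rightarrow> 'a"] less_Suc_eq_le)
    ultimately show ?thesis by (simp add: hat_apply p)
  qed
  ultimately show "p \<in> hat (Suc m) ` mcar (tuple_module (P (Suc m)))" by force
qed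

lemma image_hat: "hat (Suc m) ` mcar (tuple_module (P (Suc m))) = cycles m"
  using image_hat_subset cycles_subset_image by blast

subsection \<open>Minimality\<close>

lemma submodule_cycles: "submodule (algAf sc f) (tuple_module (P m)) (cycles m)"
  unfolding image_hat[symmetric]
  by (rule submodule_image[OF P.left_module_tuple P.left_module_tuple hom_hat])
     (rule submodule_self[OF P.left_module_tuple])

text \<open>
  The first components of a cycle are in the syzygies \<open>K\<^sub>i\<close>: below the top, the cycle condition
  expresses them through \<open>T\<close> and \<open>\<delta>\<close>, and \<open>T\<close> preserves syzygies.
\<close>

lemma superfluous_cycles: "superfluous (algAf sc f) (tuple_module (P m)) (cycles m)"
proof (rule P.superfluous_tuple)
  have "tupT (P m) ` mcar (D m) = id ` mcar (D m)"
    by (rule image_cong[OF refl]) (auto simp: Phat_simps)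
  then show "tupT (P m) ` mcar (tup0 (P m)) = mcar (tup1 (P m))" by (simp add: Phat_simps)
  show "superfluous (algA sc) (tup0 (P m)) {x. (\<forall>i\<in>{0..m}. x i \<in> K i) \<and> (\<forall>i. i \<notin> {0..m} \<longrightarrow> x i = 0)}"
    unfolding Phat_simps by (rule superfluous_direct_sum) (auto simp: Q.left_module_axioms K_superfluous)
  show "fst ` cycles m \<subseteq> {x. (\<forall>i\<in>{0..m}. x i \<in> K i) \<and> (\<forall>i. i \<notin> {0..m} \<longrightarrow> x i = 0)}"
  proof (rule image_subsetI)
    fix p assume "p \<in> cycles m"
    then obtain x y where p: "p = (x, y)" and xD: "x \<in> mcar (D m)" and yD: "y \<in> mcar (D m)"
      and top: "x m \<in> K m"
      and \<delta>x: "\<And>j. j < m \<Longrightarrow> \<delta> (Suc j) (x (Suc j)) = 0"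
      and cyc: "\<And>j. j < m \<Longrightarrow> sign_power j (x j + T (Suc j) (x (Suc j))) + \<delta> (Suc j) (y (Suc j)) = 0"
      by (auto simp: cycles_def)
    have "x j \<in> K j" if "j < m" for j
    proof -
      have mem: "x (Suc j) \<in> mcar (Q (Suc j))" "y (Suc j) \<in> mcar (Q (Suc j))"
        using xD yD that by auto
      have "x (Suc j) \<in> K (Suc j)" using mem \<delta>x[OF that] by (simp add: K_Suc)
      then have 1: "T (Suc j) (x (Suc j)) \<in> K j" using T_K[of j] by blast
      have 2: "sign_power j (\<delta> (Suc j) (y (Suc j))) \<in> K j"
        using K.sign_power_closed[of "\<delta> (Suc j) (y (Suc j))" j j] \<delta>_in_K[OF mem(2)] by simp
      have "sign_power j (x j + T (Suc j) (x (Suc j))) = - \<delta> (Suc j) (y (Suc j))"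
        using cyc[OF that] by (simp add: eq_neg_iff_add_eq_0)
      then have "sign_power j (sign_power j (x j + T (Suc j) (x (Suc j)))) = - sign_power j (\<delta> (Suc j) (y (Suc j)))"
        by (simp add: sign_power_distrib(3) del: sign_power_simps(4))
      then have "x j = - sign_power j (\<delta> (Suc j) (y (Suc j))) - T (Suc j) (x (Suc j))"
        by (simp add: eq_diff_eq)
      then show ?thesis
        using 1 2 K.diff_closed[of "- sign_power j (\<delta> (Suc j) (y (Suc j)))" j "T (Suc j) (x (Suc j))"]
          K.minus_closed[of "sign_power j (\<delta> (Suc j) (y (Suc j)))" j] by simp
    qed
    with top have "\<forall>i\<in>{0..m}. x i \<in> K i" by (auto simp: le_less)
    then show "fst p \<in> {x. (\<forall>i\<in>{0..m}. x i \<in> K i) \<and> (\<forall>i. i \<notin> {0..m} \<longrightarrow> x i = 0)}"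
      using xD by (simp add: p)
  qed
qed (rule submodule_cycles)

lemma projective_cover_hat:
  "projective_cover (algAf sc f) (tuple_module (P (Suc m)))
     (tuple_module (P m)\<lparr>mcar := cycles m\<rparr>) (hat (Suc m))"
  unfolding projective_cover_def
proof (intro conjI projective_P)
  show hom: "lmod_hom (tuple_module (P (Suc m))) (tuple_module (P m)\<lparr>mcar := cycles m\<rparr>) (hat (Suc m))"
    using image_hat_subset[of m] lmod_homD(2,3)[OF hom_hat] by (intro lmod_homI) auto
  show im: "hat (Suc m) ` mcar (tuple_module (P (Suc m))) = mcar (tuple_module (P m)\<lparr>mcar := cycles m\<rparr>)"
    by (simp add: image_hat del: tuple_module_simps)
  show "fd_module (algAf sc f) (tuple_module (P m)\<lparr>mcar := cycles m\<rparr>)"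
    using submodule_cycles[of m]
    by (intro fd_module_image[OF P.fd_module_tuple _ vector_space_Af hom im]) (simp add: submodule_def)
  show "superfluous (algAf sc f) (tuple_module (P (Suc m)))
      {x \<in> mcar (tuple_module (P (Suc m))). hat (Suc m) x = 0}"
    unfolding kernel_hat by (rule superfluous_cycles)
qed

end

lemma all_ge_one_iff: "(\<forall>i\<ge>1. R i) \<longleftrightarrow> (\<forall>i. R (Suc i))"
  by (metis One_nat_def Suc_le_D Suc_le_mono le0)

lemma minimal_projective_resolution_Suc:
  "minimal_projective_resolution A P d d0 M \<longleftrightarrow>
     projective_cover A (P 0) M d0 \<and>
     projective_cover A (P (Suc 0)) (kernel_module (P 0) d0) (d (Suc 0)) \<and>
     (\<forall>i. projective_cover A (P (Suc (Suc i))) (kernel_module (P (Suc i)) (d (Suc i))) (d (Suc (Suc i))))"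
  unfolding minimal_projective_resolution_def all_ge_one_iff by simp

theorem theorem3p10:
  fixes sc :: "'k::alg_closed_field \<Rightarrow> 'a::{ring,monoid_mult} \<Rightarrow> 'a"
    and n :: nat
    and e :: "nat \<Rightarrow> 'a"
    and f :: "'a \<Rightarrow> 'a \<Rightarrow> 'a"
    and M :: "('a, 'm::ab_group_add) lmod"
    and js :: "nat \<Rightarrow> nat list"
    and \<delta> :: "nat \<Rightarrow> (nat \<Rightarrow> 'a) \<Rightarrow> (nat \<Rightarrow> 'a)"
    and \<delta>0 :: "(nat \<Rightarrow> 'a) \<Rightarrow> 'm"
  assumes "fd_algebra (algA sc)"
    and "basic_idempotents sc n e"
    and "hochschild_2_cocycle sc f"
    and "fd_module (algA sc) M"
    and "starA_resolution sc n e f js \<delta> \<delta>0 M"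
  shows "\<exists>T :: nat \<Rightarrow> (nat \<Rightarrow> 'a) \<Rightarrow> (nat \<Rightarrow> 'a).
    (\<forall>i\<ge>1. k_linear (algA sc) (projQ e (js i)) (projQ e (js (i - 1))) (T i)) \<and>
    (\<forall>i\<ge>1. \<forall>a. \<forall>x\<in>mcar (projQ e (js i)).
       T i (mact (projQ e (js i)) a x) - mact (projQ e (js (i - 1))) a (T i x) =
       sign_power (i + 1) (fQ e f (js (i - 1)) a (\<delta> i x) - \<delta> i (fQ e f (js i) a x))) \<and>
    (\<forall>i\<ge>1. \<forall>x\<in>mcar (projQ e (js (i + 1))). T i (\<delta> (i + 1) x) = \<delta> i (T (i + 1) x)) \<and>
    (\<forall>m. is_tuple sc f (Phat e f js m)) \<and>
    is_tuple sc f (inflate M) \<and>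
    is_triple sc (Phat e f js 0) (inflate M) (hat_delta0 \<delta>0) \<and>
    (\<forall>m\<ge>1. is_triple sc (Phat e f js m) (Phat e f js (m - 1)) (hat_delta \<delta> T m)) \<and>
    minimal_projective_resolution (algAf sc f)
      (\<lambda>m. tuple_module (Phat e f js m))
      (\<lambda>m. triple_map (hat_delta \<delta> T m))
      (triple_map (hat_delta0 \<delta>0))
      (tuple_module (inflate M))"
proof -
  interpret deformation sc f by (rule deformation.intro) fact+
  interpret M: left_module "algA sc" M using assms(4) by (simp add: fd_module_def)
  let ?Q = "\<lambda>i. projQ e (js i)"
  have js: "\<And>i. set (js i) \<subseteq> {1..n}"
    and res: "minimal_projective_resolution (algA sc) ?Q \<delta> \<delta>0 M"
    and star: "\<exists>B. is_matrix_of e (js 1) (js 0) B (\<delta> 1) \<and>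
      (\<forall>x\<in>mcar (?Q 1). \<delta>0 (Tdelta e f (js 1) (js 0) B x) = 0)"
    using assms(5) by (simp_all add: starA_resolution_def)
  have primitive: "\<forall>i\<in>{1..n}. primitive_idempotent (e i)"
    using assms(2) unfolding basic_idempotents_def by (elim conjE)
  have idem: "idempotents_at e (js i)" for i
    unfolding idempotents_at_def
  proof (intro allI impI)
    fix r assume "r < length (js i)"
    then have "js i ! r \<in> {1..n}" using js[of i] nth_mem by blast
    then show "e (js i ! r) * e (js i ! r) = e (js i ! r)"
      using primitive by (simp add: primitive_idempotent_def)
  qed
  define K where "K i = (if i = 0 then {x \<in> mcar (?Q 0). \<delta>0 x = 0} else {x \<in> mcar (?Q i). \<delta> i x = 0})" for i
  have cover0: "projective_cover (algA sc) (?Q 0) M \<delta>0"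
    using res by (simp add: minimal_projective_resolution_Suc)
  have cover: "projective_cover (algA sc) (?Q (Suc i)) (?Q i\<lparr>mcar := K i\<rparr>) (\<delta> (Suc i))" for i
  proof (cases i)
    case 0
    then show ?thesis
      using res unfolding minimal_projective_resolution_Suc kernel_module_def K_def by simp
  next
    case (Suc j)
    have "K (Suc j) = {x \<in> mcar (?Q (Suc j)). \<delta> (Suc j) x = 0}" by (simp add: K_def)
    then show ?thesis
      using res unfolding minimal_projective_resolution_Suc kernel_module_def Suc by simp
  qed
  have \<delta>0_hom: "lmod_hom (?Q 0) M \<delta>0" and \<delta>0_onto: "\<delta>0 ` mcar (?Q 0) = mcar M"
    using cover0 by (simp_all add: projective_cover_def)
  have K_sub: "K i \<subseteq> mcar (?Q i)" for i by (auto simp: K_def)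
  interpret twisted_resolution sc f e js \<delta> K
  proof
    fix i
    show "idempotents_at e (js i)" by (rule idem)
    show "fd_module (algA sc) (?Q i)"
      using cover0 cover[of "i - 1"] by (cases i) (simp_all add: projective_cover_def projective_def)
    show "lmod_hom (?Q (Suc i)) (?Q i) (\<delta> (Suc i))"
      using cover[of i] K_sub[of i] by (auto simp: projective_cover_def lmod_hom_def)
    show "\<delta> (Suc i) ` mcar (?Q (Suc i)) = K i" using cover[of i] by (simp add: projective_cover_def)
    show "K (Suc i) = {x \<in> mcar (?Q (Suc i)). \<delta> (Suc i) x = 0}" by (simp add: K_def)
    show "superfluous (algA sc) (?Q i) (K i)"
      using cover0 cover[of "i - 1"] by (cases i) (simp_all add: projective_cover_def K_def)
    show "\<exists>B. is_matrix_of e (js 1) (js 0) B (\<delta> 1) \<and>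
        Tdelta e f (js 1) (js 0) B ` mcar (?Q 1) \<subseteq> K 0"
      using star by (auto simp: K_def Tdelta_closed[OF idem] image_subset_iff)
  qed
  obtain T where T: "\<forall>i. twisted i (T (Suc i)) \<and> T (Suc i) ` K (Suc i) \<subseteq> K i \<and>
    (\<forall>x\<in>mcar (Q (Suc (Suc i))). T (Suc i) (\<delta> (Suc (Suc i)) x) = \<delta> (Suc i) (T (Suc (Suc i)) x))"
    using homotopies_exist ..
  interpret twisted_resolution_homotopies sc f e js \<delta> K T
    by standard (use T in blast)+
  have tuple_M: "is_tuple sc f (inflate M)" by (rule is_tuple_inflate[OF assms(4)])
  interpret I: deformation_tuple sc f "inflate M" by standard (rule tuple_M)
  have triple0: "is_triple sc (P 0) (inflate M) (hat_delta0 \<delta>0)"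
    unfolding is_triple_def hat_delta0_def prod.case Phat_simps
    using lmod_homD[OF \<delta>0_hom]
    by (auto simp: inflate_def zero_module_def M.zero_closed kact_def intro!: lmod_homI k_linearI)
  note hom0 = lmod_hom_triple_map[OF is_tuple_P tuple_M triple0]
  have hat0: "triple_map (hat_delta0 \<delta>0) (x, y) = (0, \<delta>0 (x 0))" for x y
    by (simp add: triple_map_def hat_delta0_def)
  have kernel0: "{p \<in> mcar (tuple_module (P 0)). triple_map (hat_delta0 \<delta>0) p = 0} = cycles 0"
    by (auto simp: cycles_def Phat_simps hat0 zero_prod_def K_def)
  have "projective_cover (algAf sc f) (tuple_module (P 0)) (tuple_module (inflate M))
      (triple_map (hat_delta0 \<delta>0))"
    unfolding projective_cover_def kernel0
  proof (intro conjI projective_P I.fd_module_tuple hom0 superfluous_cycles)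
    show "triple_map (hat_delta0 \<delta>0) ` mcar (tuple_module (P 0)) = mcar (tuple_module (inflate M))"
    proof
      show "triple_map (hat_delta0 \<delta>0) ` mcar (tuple_module (P 0)) \<subseteq> mcar (tuple_module (inflate M))"
        using lmod_homD(1)[OF hom0] by blast
      show "mcar (tuple_module (inflate M)) \<subseteq> triple_map (hat_delta0 \<delta>0) ` mcar (tuple_module (P 0))"
      proof
        fix p assume "p \<in> mcar (tuple_module (inflate M))"
        then obtain y where p: "p = (0, y)" and y: "y \<in> mcar M"
          by (cases p) (auto simp: inflate_def zero_module_def)
        then obtain x where x: "x \<in> mcar (Q 0)" "y = \<delta>0 x" using \<delta>0_onto by blast
        have "(single 0 x, 0) \<in> mcar (tuple_module (P 0))"
          using x by (auto simp: Phat_simps single_def Q.zero_closed)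
        moreover have "triple_map (hat_delta0 \<delta>0) (single 0 x, 0) = p"
          by (simp add: hat0 p x(2) single_def)
        ultimately show "p \<in> triple_map (hat_delta0 \<delta>0) ` mcar (tuple_module (P 0))" by force
      qed
    qed
  qed
  then have resolution: "minimal_projective_resolution (algAf sc f) (\<lambda>m. tuple_module (P m)) hat
      (triple_map (hat_delta0 \<delta>0)) (tuple_module (inflate M))"
    unfolding minimal_projective_resolution_Suc kernel_module_def kernel0 kernel_hat
    by (intro conjI allI projective_cover_hat)
  show ?thesis
    unfolding all_ge_one_iff
    by (intro exI[of _ T] conjI)
       (use is_tuple_P tuple_M triple0 resolution is_triple_hat T_twisted T_\<delta>
          in \<open>simp_all add: twisted_def\<close>)
qed

end
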